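(* Let $(X,\mathcal{B},\mu,T)$ be a measure preserving system and let $f_1,f_2,f_3:X\to\mathbb{C}$ be bounded measurable functions. Then the averages $$M_N(f_1,f_2,f_3)(x)=\frac{1}{N^2}\sum_{n,m=0}^{N-1} f_1(T^nx)f_2(T^mx)f_3(T^{n+m}x)$$ converge as $N\to\infty$ for $\mu$-a.e. $x\in X$.
   Context: A measure preserving system $(X,\mathcal{B},\mu,T)$ is a probability space $(X,\mathcal{B},\mu)$ together with a measurable map $T:X\to X$ preserving $\mu$. *)

theory Defs
  imports "HOL-Probability.Probability"
begin

locale measure_preserving_system = prob_space M for M :: "'a measure" +
  fixes T :: "'a \<Rightarrow> 'a"
  assumes measurable_T [measurable]: "T \<in> M \<rightarrow>\<^sub>M M"
    and emeasure_T_vimage: "\<And>A. A \<in> sets M \<Longrightarrow> emeasure M (T -` A \<inter> space M) = emeasure M A"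

definition cubic_average ::
  "('a \<Rightarrow> 'a) \<Rightarrow> ('a \<Rightarrow> complex) \<Rightarrow> ('a \<Rightarrow> complex) \<Rightarrow> ('a \<Rightarrow> complex) \<Rightarrow> nat \<Rightarrow> 'a \<Rightarrow> complex"
  where "cubic_average T f1 f2 f3 N x =
    (1 / (of_nat N)\<^sup>2) *
      (\<Sum>n<N. \<Sum>m<N. f1 ((T ^^ n) x) * f2 ((T ^^ m) x) * f3 ((T ^^ (n + m)) x))"

end

theory Submission
  imports Defs
begin

text \<open>Write \<open>A\<^sub>N(s, c) = 1/N \<Sum>\<^sub>n\<^sub><\<^sub>N e\<^sup>i\<^sup>n\<^sup>s c\<^sub>n\<close> and \<open>c\<^sub>n = f\<^sub>3 (T\<^sup>n x)\<close>. By Parseval on a cyclic group, the cubic average is bounded by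
  \<open>sup\<^sub>s |A\<^sub>2\<^sub>N(s, c)|\<close>, and for \<open>c\<^sub>n = e\<^sup>i\<^sup>n\<^sup>s\<close> it factors into a product of two averages \<open>A\<^sub>N\<close>. So it
  suffices to approximate almost every orbit sequence, for each \<open>\<epsilon>\<close>, by a trigonometric polynomial \<open>q\<close>
  with \<open>sup\<^sub>s |A\<^sub>N(s, c - q)| \<le> \<epsilon>\<close> for large \<open>N\<close>.

  Let \<open>B\<close> be the invariant set of points where \<open>limsup\<^sub>N sup\<^sub>s |A\<^sub>N(s, c)| \<ge> \<epsilon>\<close>,
  and let \<open>t(x)\<close> be the first frequency at which these values cluster; \<open>t\<close> is measurable and invariant.
  The mean ergodic theorem for \<open>g \<mapsto> e\<^sup>i\<^sup>t (g \<circ> T)\<close> yields \<open>A = lim A\<^sub>N(t, f \<circ> T\<^sup>n)\<close> with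
  \<open>A \<circ> T = e\<^sup>-\<^sup>i\<^sup>t A\<close>, and the maximal ergodic theorem shows \<open>\<integral>\<^sub>B |A| \<ge> \<epsilon> \<mu>(B)\<close>. Hence subtracting
  \<open>A\<close>, a single character along each orbit, lowers \<open>\<parallel>f\<parallel>\<^sub>2\<^sup>2\<close> by at least \<open>\<epsilon>\<^sup>2 \<mu>(B)\<close>. Minimising
  \<open>\<parallel>f - p\<parallel>\<^sub>2\<close> over functions \<open>p\<close> that are trigonometric polynomials along every orbit therefore makes
  \<open>\<mu>(B)\<close> as small as we like. Allowing \<open>t\<close> to depend on \<open>x\<close> avoids the ergodic decomposition.\<close>

subsection \<open>Trigonometric averages of sequences\<close>

definition tavg :: "real \<Rightarrow> (nat \<Rightarrow> complex) \<Rightarrow> nat \<Rightarrow> complex"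
  where "tavg s c N = (\<Sum>n<N. cis (real n * s) * c n) / of_nat N"

text \<open>The inductive form lets convergence be proved one character at a time, and the rule
  \<open>add\<close> is what one step of the energy decrement supplies.\<close>

inductive trig_poly :: "(nat \<Rightarrow> complex) \<Rightarrow> bool" where
  zero: "trig_poly (\<lambda>n. 0)"
| add: "trig_poly q \<Longrightarrow> trig_poly (\<lambda>n. q n + a * cis (real n * s))"

text \<open>The threshold for \<open>N\<close> precedes the choice of \<open>s\<close>: the Fourier
  bound on cubic sums consumes a bound over all frequencies at once.\<close>

definition uniformly_trig_approx :: "(nat \<Rightarrow> complex) \<Rightarrow> bool"
  where "uniformly_trig_approx c \<longleftrightarrow>
    (\<forall>\<epsilon>>0. \<exists>q. trig_poly q \<and> (\<forall>\<^sub>F N in sequentially. \<forall>s. norm (tavg s (\<lambda>n. c n - q n) N) \<le> \<epsilon>))"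

lemma tavg_add: "tavg s (\<lambda>n. c n + d n) N = tavg s c N + tavg s d N"
  by (simp add: tavg_def sum.distrib algebra_simps add_divide_distrib)

lemma tavg_diff: "tavg s (\<lambda>n. c n - d n) N = tavg s c N - tavg s d N"
  by (simp add: tavg_def sum_subtractf algebra_simps diff_divide_distrib)

lemma tavg_mult: "tavg s (\<lambda>n. a * c n) N = a * tavg s c N"
  by (simp add: tavg_def sum_distrib_left mult_ac)

lemma tavg_zero: "tavg s (\<lambda>n. 0) N = 0"
  by (simp add: tavg_def)

text \<open>A geometric sum with ratio \<open>z = cis (s + t)\<close>: the average is 1 for
  \<open>N > 0\<close> if the ratio is 1, and otherwise O(1 / N), since the numerator of the closed
  form stays bounded.\<close>

lemma convergent_tavg_cis: "convergent (\<lambda>N. tavg s (\<lambda>n. cis (real n * t)) N)"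
proof -
  define z where "z = cis (s + t)"
  have z: "cis (real n * s) * cis (real n * t) = z ^ n" for n
    by (simp add: z_def cis_mult Complex.DeMoivre algebra_simps)
  show ?thesis
  proof (cases "z = 1")
    case True
    have "(\<lambda>N. tavg s (\<lambda>n. cis (real n * t)) N) \<longlonglongrightarrow> 1"
      by (rule tendsto_eventually, rule eventually_mono[OF eventually_gt_at_top[of 0]])
        (simp add: tavg_def z True)
    then show ?thesis by (rule convergentI)
  next
    case False
    have "(\<lambda>N. tavg s (\<lambda>n. cis (real n * t)) N) \<longlonglongrightarrow> 0"
    proof (rule Lim_null_comparison)
      show "\<forall>\<^sub>F N in sequentially. norm (tavg s (\<lambda>n. cis (real n * t)) N) \<le> (2 / norm (z - 1)) * (1 / real N)"
      proof (rule always_eventually, rule allI)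
        fix N :: nat
        have "norm (z ^ N - 1) \<le> 2"
          using norm_triangle_ineq4[of "z ^ N" 1] by (simp add: z_def norm_power)
        then have "norm (z ^ N - 1) / norm (z - 1) / real N \<le> 2 / norm (z - 1) / real N"
          by (intro divide_right_mono) auto
        then show "norm (tavg s (\<lambda>n. cis (real n * t)) N) \<le> (2 / norm (z - 1)) * (1 / real N)"
          using False by (simp add: tavg_def z geometric_sum norm_divide norm_mult)
      qed
      show "(\<lambda>N. 2 / norm (z - 1) * (1 / real N)) \<longlonglongrightarrow> 0"
        using tendsto_mult_right_zero[OF lim_1_over_n] by blast
    qed
    then show ?thesis by (rule convergentI)
  qed
qed

lemma convergent_tavg_trig_poly: "trig_poly q \<Longrightarrow> convergent (\<lambda>N. tavg s q N)"
proof (induction rule: trig_poly.induct)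
  case zero
  then show ?case by (simp add: tavg_zero convergent_const)
next
  case (add q a t)
  then show ?case
    by (simp add: tavg_add tavg_mult convergent_add convergent_mult convergent_const convergent_tavg_cis)
qed

text \<open>A three-term triangle inequality shows that \<open>X\<close> is Cauchy, so the limits of
  the approximants \<open>Y\<close> never have to be compared.\<close>

lemma convergent_uniform_approx:
  fixes X :: "nat \<Rightarrow> complex"
  assumes "\<And>\<epsilon>. \<epsilon> > 0 \<Longrightarrow> \<exists>Y. convergent Y \<and> (\<forall>\<^sub>F N in sequentially. norm (X N - Y N) \<le> \<epsilon>)"
  shows "convergent X"
  unfolding Cauchy_convergent_iff[symmetric]
proof (rule metric_CauchyI)
  fix e :: real assume "e > 0"
  then obtain Y where Y: "convergent Y" "\<forall>\<^sub>F N in sequentially. norm (X N - Y N) \<le> e / 4"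
    using assms[of "e/4"] by auto
  then obtain N0 where N0: "\<And>N. N \<ge> N0 \<Longrightarrow> norm (X N - Y N) \<le> e / 4"
    by (auto simp: eventually_sequentially)
  from Y(1) have "Cauchy Y" by (simp add: Cauchy_convergent_iff)
  then obtain N1 where N1: "\<And>m n. m \<ge> N1 \<Longrightarrow> n \<ge> N1 \<Longrightarrow> dist (Y m) (Y n) < e / 4"
    using \<open>e > 0\<close> by (metis Cauchy_def zero_less_divide_iff zero_less_numeral)
  show "\<exists>M. \<forall>m\<ge>M. \<forall>n\<ge>M. dist (X m) (X n) < e"
  proof (intro exI allI impI)
    fix m n assume "m \<ge> max N0 N1" "n \<ge> max N0 N1"
    then have "norm (X m - Y m) \<le> e/4" "norm (X n - Y n) \<le> e/4" "norm (Y m - Y n) < e/4"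
      using N0 N1[of m n] by (auto simp: dist_norm)
    moreover have "norm (X m - X n) \<le> norm (X m - Y m) + norm (Y m - Y n) + norm (X n - Y n)"
      by norm
    ultimately show "dist (X m) (X n) < e" using \<open>e > 0\<close> by (simp add: dist_norm)
  qed
qed

lemma convergent_tavg_of_approx:
  assumes "uniformly_trig_approx c"
  shows "convergent (\<lambda>N. tavg s c N)"
proof (rule convergent_uniform_approx)
  fix e :: real assume "e > 0"
  then obtain q where q: "trig_poly q" "\<forall>\<^sub>F N in sequentially. \<forall>s. norm (tavg s (\<lambda>n. c n - q n) N) \<le> e"
    using assms by (auto simp: uniformly_trig_approx_def)
  then show "\<exists>Y. convergent Y \<and> (\<forall>\<^sub>F N in sequentially. norm (tavg s c N - Y N) \<le> e)"
    by (intro exI[of _ "tavg s q"]) (auto simp: convergent_tavg_trig_poly tavg_diff elim: eventually_mono)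
qed

section \<open>Cubic sums and Fourier analysis on a cyclic group\<close>

definition cubic_sum :: "(nat \<Rightarrow> complex) \<Rightarrow> (nat \<Rightarrow> complex) \<Rightarrow> (nat \<Rightarrow> complex) \<Rightarrow> nat \<Rightarrow> complex"
  where "cubic_sum a b c N = (\<Sum>n<N. \<Sum>m<N. a n * b m * c (n + m))"

lemma cubic_sum_diff: "cubic_sum a b (\<lambda>k. c k - d k) N = cubic_sum a b c N - cubic_sum a b d N"
  by (simp add: cubic_sum_def algebra_simps sum_subtractf)

text \<open>Characters are multiplicative, so the variables \<open>n\<close> and \<open>m\<close>
  separate.\<close>

lemma cubic_sum_cis:
  "cubic_sum a b (\<lambda>k. cis (real k * s)) N / (of_nat N)\<^sup>2 = tavg s a N * tavg s b N"
proof -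
  have "cis (real (n + m) * s) = cis (real n * s) * cis (real m * s)" for n m
    by (simp add: cis_mult algebra_simps)
  then have "cubic_sum a b (\<lambda>k. cis (real k * s)) N =
      (\<Sum>n<N. cis (real n * s) * a n) * (\<Sum>m<N. cis (real m * s) * b m)"
    by (simp add: cubic_sum_def sum_product mult_ac)
  then show ?thesis by (simp add: tavg_def power2_eq_square)
qed

lemma convergent_cubic_trig_poly:
  assumes "uniformly_trig_approx a" "uniformly_trig_approx b"
  shows "trig_poly q \<Longrightarrow> convergent (\<lambda>N. cubic_sum a b q N / (of_nat N)\<^sup>2)"
proof (induction rule: trig_poly.induct)
  case zero
  then show ?case by (simp add: cubic_sum_def convergent_const)
next
  case (add q w s)
  have "cubic_sum a b (\<lambda>n. q n + w * cis (real n * s)) N / (of_nat N)\<^sup>2 =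
      cubic_sum a b q N / (of_nat N)\<^sup>2 + w * (cubic_sum a b (\<lambda>k. cis (real k * s)) N / (of_nat N)\<^sup>2)" for N
    by (simp add: cubic_sum_def sum_distrib_left algebra_simps sum.distrib add_divide_distrib)
  then show ?case
    using add convergent_tavg_of_approx[OF assms(1)] convergent_tavg_of_approx[OF assms(2)]
    by (simp add: cubic_sum_cis convergent_add convergent_mult convergent_const)
qed

text \<open>Orthogonality of the characters of the cyclic group of order \<open>P\<close>. The bound
  on \<open>d\<close> leaves 0 as the only multiple of \<open>P\<close> in range, so the ratio
  \<open>z\<close> differs from 1 for every other \<open>d\<close>.\<close>

lemma sum_roots_unity_eq:
  fixes d :: int
  assumes "P > 0" "\<bar>d\<bar> < int P"
  shows "(\<Sum>j<P. cis (of_int d * (2 * pi * real j / real P))) = (if d = 0 then of_nat P else 0)"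
proof -
  define z where "z = cis (2 * pi * of_int d / real P)"
  have z: "cis (of_int d * (2 * pi * real j / real P)) = z ^ j" for j
    by (simp add: z_def Complex.DeMoivre algebra_simps)
  show ?thesis
  proof (cases "d = 0")
    case True
    then show ?thesis by simp
  next
    case False
    have "z ^ P = 1"
      using assms by (simp add: z_def Complex.DeMoivre cis_multiple_2pi)
    moreover have "z \<noteq> 1"
    proof
      assume "z = 1"
      then have "cos (2 * pi * of_int d / real P) = 1"
        by (metis z_def cis.sel(1) one_complex.sel(1))
      then obtain k :: int where "2 * pi * of_int d / real P = of_int k * 2 * pi"
        by (auto simp: cos_one_2pi_int)
      then have "real_of_int d = of_int k * real P"
        using assms by (simp add: field_simps)
      then have "d = k * int P"
        by (metis of_int_eq_iff of_int_mult of_int_of_nat_eq)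
      with False assms(2) show False
        by (cases "k = 0") (auto simp: abs_mult mult_less_cancel_right2)
    qed
    ultimately show ?thesis
      using False by (simp only: z) (simp add: geometric_sum)
  qed
qed

text \<open>The sequence is in effect padded by zeros to length \<open>P\<close>. Indices below
  \<open>N\<close> stay distinct modulo \<open>P\<close>, so after expanding the squares
  orthogonality leaves only the diagonal.\<close>

lemma discrete_parseval:
  assumes "N \<le> P" "P > 0"
  shows "(\<Sum>j<P. (norm (\<Sum>n<N. cis (- (real n * (2 * pi * real j / real P))) * a n))\<^sup>2) =
    real P * (\<Sum>n<N. (norm (a n))\<^sup>2)"
proof -
  define \<theta> where "\<theta> j = 2 * pi * real j / real P" for j
  have "complex_of_real (\<Sum>j<P. (norm (\<Sum>n<N. cis (- (real n * \<theta> j)) * a n))\<^sup>2) =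
      (\<Sum>j<P. \<Sum>n<N. \<Sum>m<N. a n * cnj (a m) * cis (of_int (int m - int n) * \<theta> j))"
    by (simp add: complex_norm_square sum_product cis_cnj mult_ac cis_mult algebra_simps del: of_real_power)
  also have "\<dots> = (\<Sum>n<N. \<Sum>m<N. a n * cnj (a m) * (\<Sum>j<P. cis (of_int (int m - int n) * \<theta> j)))"
    by (subst sum.swap, rule sum.cong[OF refl], subst sum.swap) (simp add: sum_distrib_left)
  also have "\<dots> = (\<Sum>n<N. \<Sum>m<N. if m = n then a n * cnj (a m) * of_nat P else 0)"
  proof (intro sum.cong refl)
    fix n m assume "n \<in> {..<N}" "m \<in> {..<N}"
    then have "\<bar>int m - int n\<bar> < int P" using assms by auto
    from sum_roots_unity_eq[OF assms(2) this]
    show "a n * cnj (a m) * (\<Sum>j<P. cis (of_int (int m - int n) * \<theta> j)) =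
        (if m = n then a n * cnj (a m) * of_nat P else 0)"
      unfolding \<theta>_def by simp
  qed
  also have "\<dots> = complex_of_real (real P * (\<Sum>n<N. (norm (a n))\<^sup>2))"
    by (simp add: complex_norm_square sum_distrib_left mult_ac del: of_real_power)
  finally show ?thesis unfolding \<theta>_def of_real_eq_iff .
qed

text \<open>Inverting the discrete Fourier transform of \<open>c\<close> turns the cubic sum into a
  sum of \<open>F j * (A j * B j)\<close>. The hypothesis on \<open>c\<close> bounds
  \<open>F\<close> uniformly, and Parseval bounds the square sums of \<open>A\<close> and
  \<open>B\<close>.\<close>

lemma norm_cubic_sum_le:
  assumes a: "\<And>n. norm (a n) \<le> C" and b: "\<And>n. norm (b n) \<le> C"
    and c: "\<And>s. norm (tavg s c (2 * N)) \<le> \<epsilon>" and N: "N > 0"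
  shows "norm (cubic_sum a b c N) \<le> 2 * C\<^sup>2 * \<epsilon> * (real N)\<^sup>2"
proof -
  \<comment> \<open>The indices \<open>n + m\<close> are less than \<open>2 * N\<close>, so nothing
    wraps around modulo \<open>P\<close>.\<close>
  define P where "P = 2 * N"
  have P: "P > 0" "N \<le> P" using N by (auto simp: P_def)
  define \<theta> where "\<theta> j = 2 * pi * real j / real P" for j
  define A where "A j = (\<Sum>n<N. cis (- (real n * \<theta> j)) * a n)" for j
  define B where "B j = (\<Sum>n<N. cis (- (real n * \<theta> j)) * b n)" for j
  define F where "F j = (\<Sum>k<P. cis (real k * \<theta> j) * c k)" for j
  have "\<epsilon> \<ge> 0" using c[of 0] norm_ge_zero order_trans by blast
  have F: "norm (F j) \<le> real P * \<epsilon>" for j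
    using c[of "\<theta> j"] P by (simp add: tavg_def F_def P_def norm_divide field_simps)
  \<comment> \<open>Fourier inversion, again by orthogonality.\<close>
  have inv: "of_nat P * c l = (\<Sum>j<P. F j * cis (- (real l * \<theta> j)))" if "l < P" for l
  proof -
    have "(\<Sum>j<P. F j * cis (- (real l * \<theta> j))) =
        (\<Sum>j<P. \<Sum>k<P. c k * cis (of_int (int k - int l) * \<theta> j))"
      by (simp add: F_def sum_distrib_right sum_distrib_left cis_mult mult_ac algebra_simps)
    also have "\<dots> = (\<Sum>k<P. c k * (\<Sum>j<P. cis (of_int (int k - int l) * \<theta> j)))"
      by (subst sum.swap) (simp add: sum_distrib_left)
    also have "\<dots> = (\<Sum>k<P. if k = l then c k * of_nat P else 0)"
    proof (intro sum.cong refl)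
      fix k assume "k \<in> {..<P}"
      then have "\<bar>int k - int l\<bar> < int P" using that by auto
      from sum_roots_unity_eq[OF P(1) this]
      show "c k * (\<Sum>j<P. cis (of_int (int k - int l) * \<theta> j)) = (if k = l then c k * of_nat P else 0)"
        unfolding \<theta>_def by simp
    qed
    finally show ?thesis using that by (simp add: mult_ac)
  qed
  have "of_nat P * cubic_sum a b c N = (\<Sum>n<N. \<Sum>m<N. a n * b m * (of_nat P * c (n + m)))"
    by (simp add: cubic_sum_def sum_distrib_left mult_ac)
  also have "\<dots> = (\<Sum>n<N. \<Sum>m<N. \<Sum>j<P. F j * ((cis (- (real n * \<theta> j)) * a n) * (cis (- (real m * \<theta> j)) * b m)))"
  proof (intro sum.cong refl)
    fix n m assume "n \<in> {..<N}" "m \<in> {..<N}"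
    then have "n + m < P" by (auto simp: P_def)
    have "cis (- (real (n + m) * t)) = cis (- (real n * t)) * cis (- (real m * t))" for t
      by (simp add: cis_mult algebra_simps)
    then show "a n * b m * (of_nat P * c (n + m)) =
        (\<Sum>j<P. F j * ((cis (- (real n * \<theta> j)) * a n) * (cis (- (real m * \<theta> j)) * b m)))"
      by (simp only: inv[OF \<open>n + m < P\<close>] sum_distrib_left) (simp add: mult_ac)
  qed
  also have "\<dots> = (\<Sum>j<P. F j * (A j * B j))"
  proof -
    have "(\<Sum>n<N. \<Sum>m<N. \<Sum>j<P. F j * ((cis (- (real n * \<theta> j)) * a n) * (cis (- (real m * \<theta> j)) * b m)))
      = (\<Sum>j<P. \<Sum>n<N. \<Sum>m<N. F j * ((cis (- (real n * \<theta> j)) * a n) * (cis (- (real m * \<theta> j)) * b m)))"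
      by (simp only: sum.swap[of _ "{..<P}" "{..<N}"])
    then show ?thesis
      by (simp only: A_def B_def sum_product) (simp only: sum_distrib_left)
  qed
  finally have eq: "of_nat P * cubic_sum a b c N = (\<Sum>j<P. F j * (A j * B j))" .
  have sq: "(\<Sum>n<N. (norm (a n))\<^sup>2) \<le> real N * C\<^sup>2" "(\<Sum>n<N. (norm (b n))\<^sup>2) \<le> real N * C\<^sup>2"
    using sum_bounded_above[of "{..<N}" "\<lambda>n. (norm (a n))\<^sup>2" "C\<^sup>2"]
      sum_bounded_above[of "{..<N}" "\<lambda>n. (norm (b n))\<^sup>2" "C\<^sup>2"] a b
    by (simp_all add: power_mono)
  have "real P * norm (cubic_sum a b c N) = norm (\<Sum>j<P. F j * (A j * B j))"
    by (metis eq norm_mult norm_of_nat)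
  also have "\<dots> \<le> (\<Sum>j<P. real P * \<epsilon> * (((norm (A j))\<^sup>2 + (norm (B j))\<^sup>2) / 2))"
  proof (rule sum_norm_le)
    fix j
    \<comment> \<open>AM-GM for each \<open>j\<close> stands in for Cauchy-Schwarz over the
      sum.\<close>
    have "norm (A j) * norm (B j) \<le> ((norm (A j))\<^sup>2 + (norm (B j))\<^sup>2) / 2"
      using sum_squares_bound[of "norm (A j)" "norm (B j)"] by simp
    then show "norm (F j * (A j * B j)) \<le> real P * \<epsilon> * (((norm (A j))\<^sup>2 + (norm (B j))\<^sup>2) / 2)"
      unfolding norm_mult using F[of j] \<open>\<epsilon> \<ge> 0\<close> by (intro mult_mono) auto
  qed
  also have "\<dots> = real P * \<epsilon> * (((\<Sum>j<P. (norm (A j))\<^sup>2) + (\<Sum>j<P. (norm (B j))\<^sup>2)) / 2)"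
    by (simp only: sum.distrib[symmetric] sum_divide_distrib sum_distrib_left)
  also have "\<dots> = real P * \<epsilon> * (real P * ((\<Sum>n<N. (norm (a n))\<^sup>2) + (\<Sum>n<N. (norm (b n))\<^sup>2)) / 2)"
    unfolding A_def B_def \<theta>_def discrete_parseval[OF P(2,1)] by (simp add: algebra_simps)
  also have "\<dots> \<le> real P * \<epsilon> * (real P * (real N * C\<^sup>2 + real N * C\<^sup>2) / 2)"
    using sq \<open>\<epsilon> \<ge> 0\<close> by (intro mult_left_mono divide_right_mono add_mono) auto
  also have "\<dots> = real P * (2 * C\<^sup>2 * \<epsilon> * (real N)\<^sup>2)"
    by (simp add: P_def power2_eq_square)
  finally show ?thesis using P by simp
qed

lemma convergent_cubic_of_approx:
  assumes "uniformly_trig_approx a" "uniformly_trig_approx b" "uniformly_trig_approx c"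
    and a: "\<And>n. norm (a n) \<le> C" and b: "\<And>n. norm (b n) \<le> C"
  shows "convergent (\<lambda>N. cubic_sum a b c N / (of_nat N)\<^sup>2)"
proof (rule convergent_uniform_approx)
  fix e :: real assume "e > 0"
  \<comment> \<open>The summand 1 keeps the denominator positive when \<open>C = 0\<close>.\<close>
  define \<epsilon> where "\<epsilon> = e / (2 * C\<^sup>2 + 1)"
  have "2 * C\<^sup>2 + 1 > 0" by (simp add: add_nonneg_pos)
  then have "\<epsilon> > 0" "2 * C\<^sup>2 * \<epsilon> \<le> e" using \<open>e > 0\<close> by (auto simp: \<epsilon>_def field_simps)
  then obtain q N0 where q: "trig_poly q"
    and N0: "\<And>N s. N \<ge> N0 \<Longrightarrow> norm (tavg s (\<lambda>n. c n - q n) N) \<le> \<epsilon>"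
    using assms(3) unfolding uniformly_trig_approx_def eventually_sequentially by metis
  have "norm (cubic_sum a b c N / (of_nat N)\<^sup>2 - cubic_sum a b q N / (of_nat N)\<^sup>2) \<le> e" if "N > N0" for N
  proof -
    have "norm (cubic_sum a b (\<lambda>n. c n - q n) N) \<le> 2 * C\<^sup>2 * \<epsilon> * (real N)\<^sup>2"
      using a b that N0 by (intro norm_cubic_sum_le) auto
    also have "\<dots> \<le> e * (real N)\<^sup>2"
      using \<open>2 * C\<^sup>2 * \<epsilon> \<le> e\<close> by (intro mult_right_mono) auto
    finally show ?thesis
      using that by (simp add: cubic_sum_diff diff_divide_distrib[symmetric] norm_divide norm_power divide_le_eq)
  qed
  then show "\<exists>Y. convergent Y \<and> (\<forall>\<^sub>F N in sequentially. norm (cubic_sum a b c N / (of_nat N)\<^sup>2 - Y N) \<le> e)"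
    using convergent_cubic_trig_poly[OF assms(1,2) q] eventually_gt_at_top[of N0]
    by (intro exI[of _ "\<lambda>N. cubic_sum a b q N / (of_nat N)\<^sup>2"]) (auto elim: eventually_mono[OF eventually_gt_at_top[of N0]])
qed

subsection \<open>Large frequencies\<close>

lemma norm_tavg_le: "norm (tavg s c N) \<le> (\<Sum>n<N. norm (c n)) / real N"
  unfolding tavg_def norm_divide norm_of_nat
  by (intro divide_right_mono order_trans[OF norm_sum]) (simp_all add: norm_mult)

lemma norm_tavg_bound:
  assumes "\<And>n. norm (c n) \<le> C" "C \<ge> 0"
  shows "norm (tavg s c N) \<le> C"
proof (cases "N = 0")
  case True
  then show ?thesis using assms by (simp add: tavg_def)
next
  case False
  have "(\<Sum>n<N. norm (c n)) \<le> real N * C"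
    using sum_bounded_above[of "{..<N}" "\<lambda>n. norm (c n)" C] assms by simp
  then show ?thesis
    using False by (intro order_trans[OF norm_tavg_le]) (simp add: divide_le_eq mult.commute)
qed

lemma norm_tavg_sq_le: "(norm (tavg s c N))\<^sup>2 \<le> (\<Sum>n<N. (norm (c n))\<^sup>2) / real N"
proof -
  have "(norm (tavg s c N))\<^sup>2 \<le> ((\<Sum>n<N. norm (c n)) / real N)\<^sup>2"
    by (intro power_mono norm_tavg_le) simp
  also have "\<dots> \<le> (\<Sum>n<N. (norm (c n))\<^sup>2) / real N"
    using sum_squared_le_sum_of_squares[of "\<lambda>n. norm (c n)" "{..<N}"]
    by (cases "N = 0") (auto simp: power_divide power2_eq_square[of "real N"] field_simps)
  finally show ?thesis .
qed

text \<open>After the phase correction the two sums are windows of one sequence \<open>d\<close>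
  displaced by \<open>i\<close>, so at most \<open>i\<close> terms at each end fail to
  cancel.\<close>

lemma norm_tavg_shift:
  assumes c: "\<And>n. norm (c n) \<le> C"
  shows "norm (cis (real i * s) * tavg s (\<lambda>n. c (n + i)) N - tavg s c N) \<le> 2 * C * real i / real N"
proof -
  define d where "d n = cis (real n * s) * c n" for n
  have d: "norm (d n) \<le> C" for n using c by (simp add: d_def norm_mult)
  have "norm ((\<Sum>n<N. d (n + i)) - (\<Sum>n<N. d n)) \<le> 2 * C * real i"
  proof (induction i)
    case 0
    then show ?case by simp
  next
    case (Suc i)
    have "(\<Sum>n<N. d (n + Suc i)) - (\<Sum>n<N. d (n + i)) = d (N + i) - d i"
      using sum_lessThan_telescope[of "\<lambda>n. d (n + i)" N] by (simp add: sum_subtractf)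
    moreover have "norm (d (N + i) - d i) \<le> 2 * C"
      using norm_triangle_ineq4[of "d (N + i)" "d i"] d[of "N + i"] d[of i] by linarith
    moreover have "(\<Sum>n<N. d (n + Suc i)) - (\<Sum>n<N. d n) =
        ((\<Sum>n<N. d (n + Suc i)) - (\<Sum>n<N. d (n + i))) + ((\<Sum>n<N. d (n + i)) - (\<Sum>n<N. d n))"
      by simp
    ultimately have "norm ((\<Sum>n<N. d (n + Suc i)) - (\<Sum>n<N. d n)) \<le> 2 * C + 2 * C * real i"
      using Suc by (simp only:) (rule order_trans[OF norm_triangle_ineq add_mono])
    then show ?case by (simp add: algebra_simps)
  qed
  moreover have "cis (real i * s) * (\<Sum>n<N. cis (real n * s) * c (n + i)) = (\<Sum>n<N. d (n + i))"
    by (simp add: d_def sum_distrib_left ring_distribs cis_mult[symmetric] mult_ac)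
  ultimately show ?thesis
    unfolding tavg_def d_def[symmetric]
    by (simp add: diff_divide_distrib[symmetric] norm_divide divide_right_mono)
qed

text \<open>Interchanging the two averages exhibits the iterated one as a mean over
  \<open>i < H\<close> of phase-corrected shifts, each close to the plain average.\<close>

lemma norm_tavg_tavg:
  assumes c: "\<And>n. norm (c n) \<le> C" and "C \<ge> 0" and H: "H > 0"
  shows "norm (tavg s (\<lambda>n. tavg s (\<lambda>i. c (n + i)) H) N - tavg s c N) \<le> 2 * C * real H / real N"
proof -
  have "tavg s (\<lambda>n. tavg s (\<lambda>i. c (n + i)) H) N =
      (\<Sum>i<H. cis (real i * s) * tavg s (\<lambda>n. c (n + i)) N) / of_nat H"
  proof -
    have "(\<Sum>n<N. cis (real n * s) * (\<Sum>i<H. cis (real i * s) * c (n + i))) =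
        (\<Sum>i<H. cis (real i * s) * (\<Sum>n<N. cis (real n * s) * c (n + i)))"
      unfolding sum_distrib_left by (subst sum.swap) (simp add: mult_ac)
    then show ?thesis
      unfolding tavg_def times_divide_eq_right sum_divide_distrib[symmetric] divide_divide_eq_left
      by (simp add: mult.commute)
  qed
  then have "tavg s (\<lambda>n. tavg s (\<lambda>i. c (n + i)) H) N - tavg s c N =
      (\<Sum>i<H. cis (real i * s) * tavg s (\<lambda>n. c (n + i)) N - tavg s c N) / of_nat H"
    using H by (simp add: sum_subtractf field_simps)
  moreover have "norm (\<Sum>i<H. cis (real i * s) * tavg s (\<lambda>n. c (n + i)) N - tavg s c N)
      \<le> real H * (2 * C * real H / real N)"
  proof (rule order_trans[OF norm_sum])
    have "norm (cis (real i * s) * tavg s (\<lambda>n. c (n + i)) N - tavg s c N) \<le> 2 * C * real H / real N"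
      if "i < H" for i
      by (rule order_trans[OF norm_tavg_shift[OF c]])
        (use that \<open>C \<ge> 0\<close> in \<open>auto intro!: divide_right_mono mult_left_mono\<close>)
    then show "(\<Sum>i<H. norm (cis (real i * s) * tavg s (\<lambda>n. c (n + i)) N - tavg s c N))
        \<le> real H * (2 * C * real H / real N)"
      using sum_bounded_above[of "{..<H}"
          "\<lambda>i. norm (cis (real i * s) * tavg s (\<lambda>n. c (n + i)) N - tavg s c N)" "2 * C * real H / real N"]
      by simp
  qed
  ultimately show ?thesis
    using H by (simp add: norm_divide divide_le_eq mult_ac)
qed

lemma norm_cis_diff_le: "norm (cis a - cis b) \<le> \<bar>a - b\<bar>"
proof -
  have "cis a - cis b = cis b * (cis (a - b) - 1)"
    by (simp add: algebra_simps cis_mult)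
  then have "norm (cis a - cis b) = 2 * \<bar>sin ((a - b) / 2)\<bar>"
    by (simp only: norm_mult norm_cis cis_conv_exp dist_exp_i_1) simp
  then show ?thesis
    using abs_sin_x_le_abs_x[of "(a - b) / 2"] by simp
qed

text \<open>A chord is no longer than its arc, so for \<open>n < H\<close> the two phases differ by
  at most \<open>real H * \<bar>s - t\<bar>\<close>.\<close>

lemma norm_tavg_freq_diff:
  assumes c: "\<And>n. norm (c n) \<le> C" and "C \<ge> 0"
  shows "norm (tavg s c H - tavg t c H) \<le> C * real H * \<bar>s - t\<bar>"
proof -
  have "tavg s c H - tavg t c H = tavg 0 (\<lambda>n. (cis (real n * s) - cis (real n * t)) * c n) H"
    by (simp add: tavg_def diff_divide_distrib[symmetric] sum_subtractf left_diff_distrib)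
  also have "norm \<dots> \<le> (\<Sum>n<H. norm ((cis (real n * s) - cis (real n * t)) * c n)) / real H"
    by (rule norm_tavg_le)
  also have "\<dots> \<le> (real H * (C * real H * \<bar>s - t\<bar>)) / real H"
  proof (intro divide_right_mono)
    have "norm ((cis (real n * s) - cis (real n * t)) * c n) \<le> C * real H * \<bar>s - t\<bar>" if "n < H" for n
    proof -
      have "norm (cis (real n * s) - cis (real n * t)) \<le> real n * \<bar>s - t\<bar>"
        using norm_cis_diff_le[of "real n * s" "real n * t"]
        by (simp add: right_diff_distrib[symmetric] abs_mult)
      also have "\<dots> \<le> real H * \<bar>s - t\<bar>"
        using that by (intro mult_right_mono) auto
      finally have "norm (cis (real n * s) - cis (real n * t)) * norm (c n) \<le> (real H * \<bar>s - t\<bar>) * C"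
        using c by (intro mult_mono) auto
      then show ?thesis by (simp add: norm_mult mult_ac)
    qed
    then show "(\<Sum>n<H. norm ((cis (real n * s) - cis (real n * t)) * c n)) \<le> real H * (C * real H * \<bar>s - t\<bar>)"
      using sum_bounded_above[of "{..<H}" "\<lambda>n. norm ((cis (real n * s) - cis (real n * t)) * c n)"]
      by simp
  qed simp
  also have "\<dots> \<le> C * real H * \<bar>s - t\<bar>"
    using \<open>C \<ge> 0\<close> by (cases "H = 0") auto
  finally show ?thesis .
qed

text \<open>The frequencies are restricted to rationals for the sake of measurability, and the slack
  \<open>1 / (i + 1)\<close> makes the condition insensitive to shifting \<open>c\<close>.\<close>

definition large_freq_below :: "real \<Rightarrow> real \<Rightarrow> (nat \<Rightarrow> complex) \<Rightarrow> bool"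
  where "large_freq_below \<epsilon> r c \<longleftrightarrow> (\<forall>i::nat. \<exists>N>i. \<exists>q::rat. 0 \<le> q \<and> real_of_rat q < r \<and>
    norm (tavg (of_rat q) c N) > \<epsilon> - 1 / real (Suc i))"

lemma not_large_freq_below_iff:
  "\<not> large_freq_below \<epsilon> r c \<longleftrightarrow> (\<exists>i. \<forall>N>i. \<forall>q. 0 \<le> q \<longrightarrow> real_of_rat q < r \<longrightarrow>
    norm (tavg (of_rat q) c N) \<le> \<epsilon> - 1 / real (Suc i))"
  unfolding large_freq_below_def not_less[symmetric] by blast

lemma large_freq_below_mono: "large_freq_below \<epsilon> r c \<Longrightarrow> r \<le> r' \<Longrightarrow> large_freq_below \<epsilon> r' c"
  unfolding large_freq_below_def by (meson less_le_trans)

text \<open>An error O(1 / N) is absorbed by the slack: largeness is invoked at a later index, where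
  the smaller slack and the error together fit under \<open>1 / (i + 1)\<close>.\<close>

lemma large_freq_below_perturb:
  assumes "large_freq_below \<epsilon> r c" "D \<ge> 0"
    and le: "\<And>s N. norm (tavg s c N) \<le> norm (tavg s c' N) + D / real N"
  shows "large_freq_below \<epsilon> r c'"
  unfolding large_freq_below_def
proof
  fix i :: nat
  \<comment> \<open>For \<open>j \<ge> k\<close> the total \<open>(1 + D) / (j + 1)\<close> is at
    most \<open>1 / (i + 1)\<close>.\<close>
  obtain k :: nat where k: "(1 + D) * real (Suc i) \<le> real k"
    using real_arch_simple by blast
  define j where "j = max i k"
  obtain N q where N: "N > j" and q: "0 \<le> q" "real_of_rat q < r"
    "norm (tavg (of_rat q) c N) > \<epsilon> - 1 / real (Suc j)"
    using assms(1) unfolding large_freq_below_def by blast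
  have "1 / real (Suc j) + D / real N \<le> 1 / real (Suc j) + D / real (Suc j)"
    using N \<open>D \<ge> 0\<close> by (intro add_left_mono divide_left_mono) auto
  also have "\<dots> = (1 + D) / real (Suc j)" by (simp add: add_divide_distrib)
  also have "\<dots> \<le> 1 / real (Suc i)"
    using k by (simp add: j_def field_simps)
  finally have "norm (tavg (of_rat q) c' N) > \<epsilon> - 1 / real (Suc i)"
    using le[of "of_rat q" N] q(3) by linarith
  then show "\<exists>N>i. \<exists>q. 0 \<le> q \<and> real_of_rat q < r \<and> norm (tavg (of_rat q) c' N) > \<epsilon> - 1 / real (Suc i)"
    using N q by (intro exI[of _ N] conjI exI[of _ q]) (auto simp: j_def)
qed

text \<open>Shifting changes the averages by a phase and O(1 / N). This is the source of the
  \<open>T\<close>-invariance of the bad set and of its first frequency.\<close>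

lemma large_freq_below_Suc:
  assumes c: "\<And>n. norm (c n) \<le> C"
  shows "large_freq_below \<epsilon> r (\<lambda>n. c (Suc n)) \<longleftrightarrow> large_freq_below \<epsilon> r c"
proof -
  have "C \<ge> 0" using c[of 0] norm_ge_zero order_trans by blast
  have *: "norm (cis s * tavg s (\<lambda>n. c (Suc n)) N - tavg s c N) \<le> 2 * C / real N" for s N
    using norm_tavg_shift[of c C 1 s N] c by simp
  have **: "norm (tavg s (\<lambda>n. c (Suc n)) N) \<le> norm (tavg s c N) + 2 * C / real N"
      "norm (tavg s c N) \<le> norm (tavg s (\<lambda>n. c (Suc n)) N) + 2 * C / real N" for s N
    using *[of s N] norm_triangle_ineq3[of "cis s * tavg s (\<lambda>n. c (Suc n)) N" "tavg s c N"]
    by (auto simp: norm_mult)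
  show ?thesis
    using large_freq_below_perturb[of \<epsilon> r _ "2 * C", OF _ _ **(1)]
      large_freq_below_perturb[of \<epsilon> r _ "2 * C", OF _ _ **(2)] \<open>C \<ge> 0\<close> by auto
qed

text \<open>The bound 8 exceeds \<open>2 * pi\<close>, so that all characters are covered.\<close>

lemma not_large_freq_below:
  assumes "\<not> large_freq_below \<epsilon> 8 c"
  shows "\<forall>\<^sub>F N in sequentially. \<forall>s. norm (tavg s c N) \<le> \<epsilon>"
proof -
  obtain i where i: "\<And>N q. N > i \<Longrightarrow> 0 \<le> q \<Longrightarrow> real_of_rat q < 8 \<Longrightarrow>
      norm (tavg (of_rat q) c N) \<le> \<epsilon> - 1 / real (Suc i)"
    using assms unfolding not_large_freq_below_iff by blast
  have *: "norm (tavg s c N) \<le> \<epsilon>" if "N > i" "0 \<le> s" "s < 8" for N s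
  proof (rule ccontr)
    assume "\<not> norm (tavg s c N) \<le> \<epsilon>"
    moreover have "continuous_on UNIV (\<lambda>s. norm (tavg s c N))"
      unfolding tavg_def by (cases "N = 0") (auto intro!: continuous_intros)
    \<comment> \<open>Approaching from the right keeps the rational frequency nonnegative, and
      \<open>s < 8\<close> leaves room for it.\<close>
    ultimately have "\<forall>\<^sub>F u in at_right s. norm (tavg u c N) > \<epsilon>"
      by (intro order_tendstoD(1)[of _ "norm (tavg s c N)"])
        (auto simp: continuous_on_def intro: tendsto_within_subset)
    then obtain b where b: "b > s" "\<And>u. s < u \<Longrightarrow> u < b \<Longrightarrow> norm (tavg u c N) > \<epsilon>"
      by (auto simp: eventually_at_right_field)
    have "s < min b 8" using b(1) that by simp
    then obtain q where q: "s < real_of_rat q" "real_of_rat q < min b 8"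
      using of_rat_dense by blast
    then have "real_of_rat q \<ge> 0" using that by linarith
    then have "norm (tavg (of_rat q) c N) \<le> \<epsilon> - 1 / real (Suc i)"
      using that q by (intro i) auto
    moreover have "1 / real (Suc i) \<ge> 0" by simp
    moreover have "norm (tavg (of_rat q) c N) > \<epsilon>" using b(2)[of "of_rat q"] q by simp
    ultimately show False by linarith
  qed
  have "norm (tavg s c N) \<le> \<epsilon>" if "N > i" for N s
  proof -
    \<comment> \<open>Reduction modulo \<open>2 * pi\<close> brings any frequency into the range
      already treated.\<close>
    define k where "k = \<lfloor>s / (2 * pi)\<rfloor>"
    define s' where "s' = s - 2 * pi * of_int k"
    have k: "of_int k \<le> s / (2 * pi)" "s / (2 * pi) < of_int k + 1"
      unfolding k_def by linarith+
    have "0 \<le> s'" "s' < 2 * pi"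
      using k pi_gt_zero by (simp_all add: s'_def field_simps)
    moreover have "cis (real n * s) = cis (real n * s')" for n
    proof -
      have "real n * s = real n * s' + 2 * pi * of_int (int n * k)"
        by (simp add: s'_def algebra_simps)
      then show ?thesis
        by (simp only: cis_mult[symmetric] cis_multiple_2pi Ints_of_int mult_1_right)
    qed
    then have "tavg s c N = tavg s' c N" by (simp add: tavg_def)
    ultimately show ?thesis
      using *[OF that, of s'] pi_less_4 by simp
  qed
  then show ?thesis
    unfolding eventually_sequentially by (intro exI[of _ "Suc i"]) simp
qed

definition first_large_freq :: "real \<Rightarrow> (nat \<Rightarrow> complex) \<Rightarrow> real"
  where "first_large_freq \<epsilon> c = Inf {r \<in> {0..8}. r = 8 \<or> large_freq_below \<epsilon> r c}"

text \<open>Monotonicity in \<open>r\<close> lets rational thresholds replace real ones. The strict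
  sublevel sets thus become countable unions, which gives measurability.\<close>

lemma first_large_freq_less_iff:
  "first_large_freq \<epsilon> c < y \<longleftrightarrow>
    y > 8 \<or> (\<exists>q::rat. 0 \<le> q \<and> real_of_rat q \<le> 8 \<and> real_of_rat q < y \<and> large_freq_below \<epsilon> (of_rat q) c)"
    (is "?L \<longleftrightarrow> ?R")
proof -
  let ?S = "{r \<in> {0..8::real}. r = 8 \<or> large_freq_below \<epsilon> r c}"
  have "(8::real) \<in> ?S" by simp
  then have "?S \<noteq> {}" by blast
  then have iff: "?L \<longleftrightarrow> (\<exists>r\<in>?S. r < y)"
    unfolding first_large_freq_def by (intro cInf_less_iff) auto
  show ?thesis
  proof
    assume ?L
    then obtain r where r: "r \<in> ?S" "r < y" using iff by blast
    show ?R
    proof (cases "y > 8")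
      case False
      then have "r < 8" "large_freq_below \<epsilon> r c" "0 \<le> r" using r by auto
      then obtain q where q: "r < real_of_rat q" "real_of_rat q < y"
        using r(2) of_rat_dense by blast
      with \<open>0 \<le> r\<close> have "real_of_rat q \<ge> 0" by linarith
      then show ?thesis
        using False q large_freq_below_mono[OF \<open>large_freq_below \<epsilon> r c\<close>, of "of_rat q"]
        by (intro disjI2 exI[of _ q]) auto
    qed simp
  next
    assume ?R
    then show ?L
    proof
      assume "y > 8" then show ?L using iff \<open>8 \<in> ?S\<close> by blast
    next
      assume "\<exists>q::rat. 0 \<le> q \<and> real_of_rat q \<le> 8 \<and> real_of_rat q < y \<and> large_freq_below \<epsilon> (of_rat q) c"
      then obtain q :: rat where "real_of_rat q \<in> ?S" "real_of_rat q < y" by auto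
      then show ?L using iff by blast
    qed
  qed
qed

text \<open>Large values recur at frequencies below \<open>\<tau> + \<delta>\<close>, while those
  below \<open>\<tau> - \<delta>\<close> eventually stay small by a margin; for long averages only
  the window in between remains.\<close>

lemma first_large_freq_cluster:
  assumes big: "large_freq_below \<epsilon> 8 c" and "\<delta> > 0"
  shows "\<exists>N>i. \<exists>s. \<bar>s - first_large_freq \<epsilon> c\<bar> \<le> \<delta> \<and> norm (tavg s c N) > \<epsilon> - 1 / real (Suc i)"
proof -
  let ?S = "{r \<in> {0..8::real}. r = 8 \<or> large_freq_below \<epsilon> r c}"
  define \<tau> where "\<tau> = first_large_freq \<epsilon> c"
  have \<tau>: "\<tau> = Inf ?S" by (simp add: \<tau>_def first_large_freq_def)
  have ne: "?S \<noteq> {}" "bdd_below ?S" by (auto simp: bdd_below_def)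
  have "\<tau> \<ge> 0" unfolding \<tau> using ne(1) by (intro cInf_greatest) auto
  have "Inf ?S < \<tau> + \<delta>" using \<open>\<delta> > 0\<close> \<tau> by simp
  then obtain r where r: "r \<in> ?S" "r < \<tau> + \<delta>" using cInf_less_iff[OF ne] by blast
  then have up: "large_freq_below \<epsilon> (\<tau> + \<delta>) c"
    using big by (auto intro: large_freq_below_mono)
  have "\<exists>j. \<forall>N>j. \<forall>q::rat. 0 \<le> q \<longrightarrow> real_of_rat q < \<tau> - \<delta> \<longrightarrow>
      norm (tavg (of_rat q) c N) \<le> \<epsilon> - 1 / real (Suc j)"
  \<comment> \<open>If \<open>\<tau> - \<delta>\<close> is nonnegative, largeness below it would
    contradict the infimum; otherwise no nonnegative rational lies below it.\<close>
  proof (cases "\<tau> - \<delta> \<ge> 0")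
    case True
    have "\<tau> \<le> 8" unfolding \<tau> using ne by (intro cInf_lower) auto
    have "\<not> large_freq_below \<epsilon> (\<tau> - \<delta>) c"
    proof
      assume "large_freq_below \<epsilon> (\<tau> - \<delta>) c"
      then have "\<tau> - \<delta> \<in> ?S" using True \<open>\<tau> \<le> 8\<close> \<open>\<delta> > 0\<close> by auto
      then have "\<tau> \<le> \<tau> - \<delta>" unfolding \<tau> using ne(2) by (intro cInf_lower) (simp add: \<tau>[symmetric])+
      then show False using \<open>\<delta> > 0\<close> by simp
    qed
    then show ?thesis unfolding not_large_freq_below_iff .
  next
    case False
    have "\<not> real_of_rat q < \<tau> - \<delta>" if "0 \<le> q" for q
    proof -
      have "real_of_rat q \<ge> 0" using that by simp
      then show ?thesis using False by linarith
    qed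
    then show ?thesis by blast
  qed
  then obtain j where j: "\<And>N q. N > j \<Longrightarrow> 0 \<le> q \<Longrightarrow> real_of_rat q < \<tau> - \<delta> \<Longrightarrow>
      norm (tavg (of_rat q) c N) \<le> \<epsilon> - 1 / real (Suc j)"
    by blast
  \<comment> \<open>Going beyond \<open>j\<close> as well makes the slack at most the margin, which
    excludes frequencies below \<open>\<tau> - \<delta>\<close>.\<close>
  obtain N q where N: "N > max i j" and q: "0 \<le> q" "real_of_rat q < \<tau> + \<delta>"
    "norm (tavg (of_rat q) c N) > \<epsilon> - 1 / real (Suc (max i j))"
    using up unfolding large_freq_below_def by blast
  have "1 / real (Suc (max i j)) \<le> 1 / real (Suc j)" "1 / real (Suc (max i j)) \<le> 1 / real (Suc i)"
    by (auto simp: field_simps)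
  then have "norm (tavg (of_rat q) c N) > \<epsilon> - 1 / real (Suc j)" "norm (tavg (of_rat q) c N) > \<epsilon> - 1 / real (Suc i)"
    using q(3) by linarith+
  moreover from this have "\<not> real_of_rat q < \<tau> - \<delta>"
    using j[of N q] N q(1) by auto
  moreover from this have "\<bar>real_of_rat q - \<tau>\<bar> \<le> \<delta>" using q(2) by linarith
  ultimately show ?thesis
    using N unfolding \<tau>_def[symmetric] by (intro exI[of _ N] conjI exI[of _ "of_rat q"]) auto
qed

text \<open>Averaging over blocks of length \<open>H\<close> first costs \<open>O(H / N)\<close>, and freezing the frequency of
  the blocks costs \<open>O(H * \<bar>s - t\<bar>)\<close>.\<close>

lemma block_averages_large:
  assumes c: "\<And>n. norm (c n) \<le> C" and big: "large_freq_below \<epsilon> 8 c" and H: "H > 0" and "e < \<epsilon>"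
  shows "\<exists>N>0. e * real N < (\<Sum>n<N. norm (tavg (first_large_freq \<epsilon> c) (\<lambda>i. c (n + i)) H))"
proof -
  define \<tau> where "\<tau> = first_large_freq \<epsilon> c"
  define \<eta> where "\<eta> = (\<epsilon> - e) / 3"
  have "\<eta> > 0" using \<open>e < \<epsilon>\<close> by (simp add: \<eta>_def)
  have "C \<ge> 0" using c[of 0] norm_ge_zero order_trans by blast
  define \<delta> where "\<delta> = \<eta> / (C * real H + 1)"
  have pos: "C * real H + 1 > 0" using \<open>C \<ge> 0\<close> by (simp add: add_nonneg_pos)
  then have "\<delta> > 0" "C * real H * \<delta> \<le> \<eta>"
    using \<open>\<eta> > 0\<close> by (simp_all add: \<delta>_def field_simps)
  obtain i :: nat where i: "(1 + 2 * C * real H) / \<eta> \<le> real i"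
    using real_arch_simple by blast
  have "0 < (1 + 2 * C * real H) / \<eta>"
    using \<open>\<eta> > 0\<close> \<open>C \<ge> 0\<close> by (intro divide_pos_pos add_pos_nonneg) auto
  then have "real i > 0" using i by linarith
  obtain N s where N: "N > i" and s: "\<bar>s - \<tau>\<bar> \<le> \<delta>" "norm (tavg s c N) > \<epsilon> - 1 / real (Suc i)"
    using first_large_freq_cluster[OF big \<open>\<delta> > 0\<close>, of i] unfolding \<tau>_def by blast
  have 1: "1 / real (Suc i) \<le> \<eta>" and 2: "2 * C * real H / real N \<le> \<eta>"
  proof -
    have le: "1 + 2 * C * real H \<le> \<eta> * real i"
      using i \<open>\<eta> > 0\<close> by (simp add: field_simps)
    have "2 * C * real H \<ge> 0" using \<open>C \<ge> 0\<close> by simp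
    moreover have "\<eta> * real i \<le> \<eta> * real (Suc i)" "\<eta> * real i \<le> \<eta> * real N"
      using N \<open>\<eta> > 0\<close> by (auto intro!: mult_left_mono)
    ultimately have "1 \<le> \<eta> * real (Suc i)" "2 * C * real H \<le> \<eta> * real N"
      using le by linarith+
    then show "1 / real (Suc i) \<le> \<eta>" "2 * C * real H / real N \<le> \<eta>"
      using N by (simp_all add: divide_le_eq)
  qed
  have "norm (tavg s c N) \<le> norm (tavg s (\<lambda>n. tavg s (\<lambda>i. c (n + i)) H) N) + 2 * C * real H / real N"
    using norm_tavg_tavg[of c C H s N, OF c \<open>C \<ge> 0\<close> H]
      norm_triangle_ineq3[of "tavg s (\<lambda>n. tavg s (\<lambda>i. c (n + i)) H) N" "tavg s c N"] by linarith
  also have "norm (tavg s (\<lambda>n. tavg s (\<lambda>i. c (n + i)) H) N) \<le> (\<Sum>n<N. norm (tavg s (\<lambda>i. c (n + i)) H)) / real N"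
    by (rule norm_tavg_le)
  also have "(\<Sum>n<N. norm (tavg s (\<lambda>i. c (n + i)) H)) \<le> (\<Sum>n<N. norm (tavg \<tau> (\<lambda>i. c (n + i)) H) + \<eta>)"
  proof (rule sum_mono)
    fix n
    have "norm (tavg s (\<lambda>i. c (n + i)) H - tavg \<tau> (\<lambda>i. c (n + i)) H) \<le> C * real H * \<bar>s - \<tau>\<bar>"
      using c \<open>C \<ge> 0\<close> by (rule norm_tavg_freq_diff)
    also have "\<dots> \<le> C * real H * \<delta>"
      using s(1) \<open>C \<ge> 0\<close> by (intro mult_left_mono) auto
    also have "\<dots> \<le> \<eta>" by fact
    finally show "norm (tavg s (\<lambda>i. c (n + i)) H) \<le> norm (tavg \<tau> (\<lambda>i. c (n + i)) H) + \<eta>"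
      using norm_triangle_ineq2[of "tavg s (\<lambda>i. c (n + i)) H" "tavg \<tau> (\<lambda>i. c (n + i)) H"] by linarith
  qed
  also have "(\<Sum>n<N. norm (tavg \<tau> (\<lambda>i. c (n + i)) H) + \<eta>) / real N =
      (\<Sum>n<N. norm (tavg \<tau> (\<lambda>i. c (n + i)) H)) / real N + \<eta>"
    using N by (simp add: sum.distrib add_divide_distrib)
  finally have "\<epsilon> - 3 * \<eta> < (\<Sum>n<N. norm (tavg \<tau> (\<lambda>i. c (n + i)) H)) / real N"
    using 1 2 s(2) by (simp add: divide_right_mono)
  moreover have "\<epsilon> - 3 * \<eta> = e" by (simp add: \<eta>_def field_simps)
  ultimately show ?thesis
    using N unfolding \<tau>_def[symmetric] by (intro exI[of _ N]) (simp add: field_simps)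
qed

subsection \<open>Ergodic theorems\<close>

context measure_preserving_system
begin

lemma measurable_funpow [measurable]: "(T ^^ n) \<in> M \<rightarrow>\<^sub>M M"
  by (induction n) (auto intro: measurable_comp)

lemma funpow_in_space: "x \<in> space M \<Longrightarrow> (T ^^ n) x \<in> space M"
  using measurable_funpow by (rule measurable_space)

lemma integral_T:
  fixes g :: "'a \<Rightarrow> 'b::{banach, second_countable_topology}"
  assumes "g \<in> borel_measurable M"
  shows "(\<integral>x. g (T x) \<partial>M) = (\<integral>x. g x \<partial>M)"
proof -
  have "distr M M T = M"
    by (rule measure_eqI) (simp_all add: emeasure_distr emeasure_T_vimage)
  then show ?thesis
    using integral_distr[OF measurable_T assms] by simp
qed

lemma integral_funpow:
  fixes g :: "'a \<Rightarrow> 'b::{banach, second_countable_topology}"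
  assumes [measurable]: "g \<in> borel_measurable M"
  shows "(\<integral>x. g ((T ^^ n) x) \<partial>M) = (\<integral>x. g x \<partial>M)"
proof (induction n)
  case (Suc n)
  have "(\<integral>x. g ((T ^^ Suc n) x) \<partial>M) = (\<integral>x. g ((T ^^ n) (T x)) \<partial>M)"
    by (simp only: funpow_Suc_right comp_def)
  also have "\<dots> = (\<integral>x. g x \<partial>M)"
    using integral_T[of "\<lambda>x. g ((T ^^ n) x)"] Suc by simp
  finally show ?case .
qed simp

lemma integrable_bounded:
  fixes g :: "'a \<Rightarrow> 'b::{banach, second_countable_topology}"
  assumes "g \<in> borel_measurable M" "\<And>x. norm (g x) \<le> K"
  shows "integrable M g"
  using assms by (intro integrable_const_bound[of _ K]) auto

text \<open>Garsia's argument: \<open>m K\<close> is the maximum of the first \<open>K\<close> Birkhoff sums of \<open>g\<close> (and 0).\<close>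

lemma maximal_ergodic:
  fixes G :: "'a \<Rightarrow> real"
  assumes G [measurable]: "G \<in> borel_measurable M" and G_le: "\<And>x. \<bar>G x\<bar> \<le> K"
    and B [measurable]: "B \<in> sets M"
    and inv: "\<And>x. x \<in> space M \<Longrightarrow> T x \<in> B \<longleftrightarrow> x \<in> B"
    and large: "\<And>x. x \<in> B \<Longrightarrow> \<exists>N>0. e * real N < (\<Sum>n<N. G ((T ^^ n) x))"
  shows "e * measure M B \<le> (\<integral>x. indicator B x * G x \<partial>M)"
proof -
  define g where "g x = indicator B x * (G x - e)" for x
  have [measurable]: "g \<in> borel_measurable M" unfolding g_def by measurable
  have g_le: "\<bar>g x\<bar> \<le> K + \<bar>e\<bar>" for x
    using G_le[of x] by (auto simp: g_def indicator_def)
  have "K \<ge> 0" using G_le[of undefined] by linarith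
  define m where "m = rec_nat (\<lambda>x. 0) (\<lambda>_ h x. max 0 (g x + h (T x)))"
  have m0: "m 0 x = 0" and mSuc: "m (Suc k) x = max 0 (g x + m k (T x))" for k x
    by (simp_all add: m_def)
  have m_meas [measurable]: "m k \<in> borel_measurable M" for k
  proof (induction k)
    case 0
    have "m 0 = (\<lambda>x. 0)" by (simp add: fun_eq_iff m0)
    then show ?case by simp
  next
    case (Suc k)
    note [measurable] = Suc
    have "m (Suc k) = (\<lambda>x. max 0 (g x + m k (T x)))" by (simp add: fun_eq_iff mSuc)
    then show ?case by simp
  qed
  have m_nonneg: "m k x \<ge> 0" for k x
    by (cases k) (simp_all add: m0 mSuc)
  have m_mono: "m k x \<le> m (Suc k) x" for k x
  proof (induction k arbitrary: x)
    case 0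
    then show ?case by (simp add: m0 m_nonneg)
  next
    case (Suc k)
    have "m k (T x) \<le> m (Suc k) (T x)" by (rule Suc)
    then show ?case unfolding mSuc[of k x] mSuc[of "Suc k" x] by simp
  qed
  have m_bound: "\<bar>m k x\<bar> \<le> real k * (K + \<bar>e\<bar>)" for k x
  proof (induction k arbitrary: x)
    case 0
    then show ?case by (simp add: m0)
  next
    case (Suc k)
    have "0 \<le> real (Suc k) * (K + \<bar>e\<bar>)" using \<open>K \<ge> 0\<close> by simp
    moreover have "g x + m k (T x) \<le> (K + \<bar>e\<bar>) + real k * (K + \<bar>e\<bar>)"
      using g_le[of x] Suc[of "T x"] by linarith
    ultimately show ?case
      using m_nonneg[of "Suc k" x] by (simp add: mSuc algebra_simps)
  qed
  have int_m: "integrable M (m k)" for k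
    using m_bound by (intro integrable_bounded[of _ "real k * (K + \<bar>e\<bar>)"]) auto
  have int_mT: "integrable M (\<lambda>x. m k (T x))" for k
    using m_bound by (intro integrable_bounded[of _ "real k * (K + \<bar>e\<bar>)"]) auto
  have nonneg: "0 \<le> (\<integral>x. (if 0 < m (Suc k) x then g x else 0) \<partial>M)" for k
  proof -
    \<comment> \<open>\<open>m\<close> increases with \<open>k\<close>, and \<open>m k\<close> has
      the same integral as its composition with \<open>T\<close>. Where \<open>m (Suc k)\<close> is
      positive, the resulting integrand equals \<open>g\<close>; elsewhere it is at most 0.\<close>
    have "0 \<le> (\<integral>x. m (Suc k) x \<partial>M) - (\<integral>x. m k x \<partial>M)"
      using m_mono by (auto intro!: integral_mono int_m)
    also have "\<dots> = (\<integral>x. m (Suc k) x - m k (T x) \<partial>M)"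
      by (simp add: int_m int_mT integral_T)
    also have "\<dots> \<le> (\<integral>x. (if 0 < m (Suc k) x then g x else 0) \<partial>M)"
    proof (rule integral_mono)
      show "integrable M (\<lambda>x. if 0 < m (Suc k) x then g x else 0)"
        using g_le \<open>K \<ge> 0\<close> by (intro integrable_bounded[of _ "K + \<bar>e\<bar>"]) auto
      show "m (Suc k) x - m k (T x) \<le> (if 0 < m (Suc k) x then g x else 0)" for x
        using m_nonneg[of k "T x"] by (auto simp: mSuc max_def)
    qed (simp add: int_m int_mT)
    finally show ?thesis .
  qed
  have sum_le: "(\<Sum>n<N. g ((T ^^ n) x)) \<le> m N x" for N x
  proof (induction N arbitrary: x)
    case 0
    then show ?case by (simp add: m0)
  next
    case (Suc N)
    have "(\<Sum>n<Suc N. g ((T ^^ n) x)) = g x + (\<Sum>n<N. g ((T ^^ n) (T x)))"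
      by (simp only: sum.lessThan_Suc_shift funpow_Suc_right comp_def) simp
    then show ?case using Suc[of "T x"] by (simp add: mSuc)
  qed
  have inv_n: "(T ^^ n) x \<in> B \<longleftrightarrow> x \<in> B" if "x \<in> space M" for n x
    using that by (induction n) (auto simp: inv funpow_in_space)
  \<comment> \<open>On \<open>B\<close> some Birkhoff sum of \<open>g\<close> is positive, hence so
    is \<open>m\<close> from there on; off \<open>B\<close> the function \<open>g\<close> vanishes.
    So the truncations converge to \<open>g\<close> pointwise.\<close>
  have "(\<lambda>k. \<integral>x. (if 0 < m (Suc k) x then g x else 0) \<partial>M) \<longlonglongrightarrow> (\<integral>x. g x \<partial>M)"
  proof (rule integral_dominated_convergence[where w = "\<lambda>_. K + \<bar>e\<bar>"])
    show "AE x in M. (\<lambda>k. if 0 < m (Suc k) x then g x else 0) \<longlonglongrightarrow> g x"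
    proof (rule AE_I2)
      fix x assume x: "x \<in> space M"
      show "(\<lambda>k. if 0 < m (Suc k) x then g x else 0) \<longlonglongrightarrow> g x"
      proof (cases "x \<in> B")
        case True
        then obtain N where N: "N > 0" "e * real N < (\<Sum>n<N. G ((T ^^ n) x))" using large by blast
        have "(\<Sum>n<N. g ((T ^^ n) x)) = (\<Sum>n<N. G ((T ^^ n) x)) - e * real N"
          using True inv_n[OF x] by (simp add: g_def sum_subtractf)
        then have "0 < m N x" using sum_le[of x N] N by linarith
        moreover have "m N x \<le> m k x" if "k \<ge> N" for k
          using lift_Suc_mono_le[of "\<lambda>k. m k x"] m_mono that by blast
        ultimately have "\<forall>\<^sub>F k in sequentially. (if 0 < m (Suc k) x then g x else 0) = g x"
          unfolding eventually_sequentially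
          by (intro exI[of _ N]) (metis le_Suc_eq less_le_trans)
        then show ?thesis by (rule tendsto_eventually)
      qed (simp add: g_def cong: if_cong)
    qed
  qed (use g_le \<open>K \<ge> 0\<close> in auto)
  then have "0 \<le> (\<integral>x. g x \<partial>M)"
    by (rule LIMSEQ_le_const) (use nonneg in auto)
  also have "(\<integral>x. g x \<partial>M) = (\<integral>x. indicator B x * G x - e * indicator B x \<partial>M)"
    by (simp add: g_def algebra_simps)
  also have "\<dots> = (\<integral>x. indicator B x * G x \<partial>M) - e * measure M B"
  proof -
    have "integrable M (\<lambda>x. indicator B x * G x)"
      using G_le \<open>K \<ge> 0\<close> by (intro integrable_bounded[of _ K]) (auto simp: indicator_def)
    moreover have "integrable M (\<lambda>x. e * indicator B x)"
      by (intro integrable_bounded[of _ "\<bar>e\<bar>"]) (auto simp: indicator_def)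
    ultimately show ?thesis by simp
  qed
  finally show ?thesis by simp
qed

section \<open>Mean ergodic theorem with an invariant frequency\<close>

abbreviation orbit :: "('a \<Rightarrow> complex) \<Rightarrow> 'a \<Rightarrow> nat \<Rightarrow> complex"
  where "orbit f x \<equiv> \<lambda>n. f ((T ^^ n) x)"

lemma orbit_funpow: "orbit f ((T ^^ n) x) = (\<lambda>i. orbit f x (n + i))"
proof
  fix i
  show "orbit f ((T ^^ n) x) i = orbit f x (n + i)"
    by (metis add.commute comp_apply funpow_add)
qed

lemma orbit_T: "orbit f (T x) = (\<lambda>n. orbit f x (Suc n))"
  using orbit_funpow[of f 1 x] by simp

text \<open>The mean ergodic theorem for the isometry \<open>g \<mapsto> cis t * (g \<circ> T)\<close>.\<close>

lemma mean_ergodic: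
  assumes f [measurable]: "f \<in> borel_measurable M" and f_le: "\<And>x. norm (f x) \<le> C"
    and t [measurable]: "t \<in> borel_measurable M" and t_inv: "\<And>x. t (T x) = t x"
  obtains A where "A \<in> borel_measurable M" and "\<And>x. norm (A x) \<le> C"
    and "\<And>x n. A ((T ^^ n) x) = A x * cis (real n * - t x)"
    and "(\<integral>x. (norm (f x - A x))\<^sup>2 \<partial>M) = (\<integral>x. (norm (f x))\<^sup>2 \<partial>M) - (\<integral>x. (norm (A x))\<^sup>2 \<partial>M)"
    and "\<And>B e. B \<in> sets M \<Longrightarrow> (\<And>H. H > 0 \<Longrightarrow> e \<le> (\<integral>x. indicator B x * norm (tavg (t x) (orbit f x) H) \<partial>M)) \<Longrightarrow>
      e \<le> (\<integral>x. indicator B x * norm (A x) \<partial>M)"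
proof -
  have "C \<ge> 0" using f_le[of undefined] norm_ge_zero order_trans by blast
  have [measurable]: "cnj \<in> borel_measurable borel"
    by (intro borel_measurable_continuous_onI continuous_intros)
  have t_inv_n: "t ((T ^^ n) x) = t x" for n x
    by (induction n) (simp_all add: t_inv)
  define avg where "avg g N x = tavg (t x) (orbit g x) N" for g N x
  have avg_meas [measurable]: "avg g N \<in> borel_measurable M" if [measurable]: "g \<in> borel_measurable M" for g N
    unfolding avg_def tavg_def cis_conv_exp by measurable
  have avg_le: "norm (avg f N x) \<le> C" for N x
    unfolding avg_def by (intro norm_tavg_bound f_le \<open>C \<ge> 0\<close>)
  have sq_int: "integrable M (\<lambda>x. (norm (g x))\<^sup>2)" if "g \<in> borel_measurable M" "\<And>x. norm (g x) \<le> K"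
    for g :: "'a \<Rightarrow> complex" and K
    using that by (intro integrable_bounded[of _ "K\<^sup>2"]) (auto intro: power_mono)
  \<comment> \<open>Cauchy-Schwarz along the orbit and invariance of the measure make averaging a
    contraction in L2.\<close>
  have contr: "(\<integral>x. (norm (avg g N x))\<^sup>2 \<partial>M) \<le> (\<integral>x. (norm (g x))\<^sup>2 \<partial>M)"
    if g [measurable]: "g \<in> borel_measurable M" and g_le: "\<And>x. norm (g x) \<le> C" for g N
  proof (cases "N = 0")
    case True
    then show ?thesis by (simp add: avg_def tavg_def)
  next
    case False
    have int: "integrable M (\<lambda>x. (norm (orbit g x n))\<^sup>2)" for n
      using g_le by (intro sq_int[of _ C]) auto
    have "(\<integral>x. (norm (avg g N x))\<^sup>2 \<partial>M) \<le> (\<integral>x. (\<Sum>n<N. (norm (orbit g x n))\<^sup>2) / real N \<partial>M)"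
    proof (rule integral_mono)
      show "integrable M (\<lambda>x. (norm (avg g N x))\<^sup>2)"
        unfolding avg_def using g_le \<open>C \<ge> 0\<close>
        by (intro sq_int[of _ C] norm_tavg_bound) (use avg_meas[OF g] in \<open>simp add: avg_def[abs_def]\<close>)
      show "integrable M (\<lambda>x. (\<Sum>n<N. (norm (orbit g x n))\<^sup>2) / real N)"
        using int by simp
    qed (simp add: avg_def norm_tavg_sq_le)
    also have "\<dots> = (\<Sum>n<N. \<integral>x. (norm (orbit g x n))\<^sup>2 \<partial>M) / real N"
      using int by simp
    also have "\<dots> = (\<integral>x. (norm (g x))\<^sup>2 \<partial>M)"
      using False integral_funpow[of "\<lambda>x. (norm (g x))\<^sup>2"] by simp
    finally show ?thesis .
  qed
  define W where "W N = (\<integral>x. (norm (avg f N x))\<^sup>2 \<partial>M)" for N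
  define h where "h H K x = (avg f H x + avg f K x) / 2" for H K x
  have h_meas [measurable]: "h H K \<in> borel_measurable M" for H K
    unfolding h_def[abs_def] by measurable
  have h_le: "norm (h H K x) \<le> C" for H K x
    using norm_triangle_ineq[of "avg f H x" "avg f K x"] avg_le[of H x] avg_le[of K x]
    by (simp add: h_def norm_divide)
  text \<open>Averaging does not increase the norm, and a preliminary averaging hardly changes \<open>avg f N\<close> for
    large \<open>N\<close>; so the infimum \<open>m\<close> of the norms below also bounds \<open>h H K\<close>, and the parallelogram
    law makes the averages Cauchy.\<close>
  have h_lower: "W N \<le> (\<integral>x. (norm (h H K x))\<^sup>2 \<partial>M) + 4 * C\<^sup>2 * real (H + K) / real N"
    if "H > 0" "K > 0" for H K N
  proof -
    have avg_avg: "norm (avg (avg f L) N x - avg f N x) \<le> 2 * C * real L / real N" if "L > 0" for L x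
    proof -
      have "orbit (avg f L) x = (\<lambda>n. tavg (t x) (\<lambda>i. orbit f x (n + i)) L)"
        by (simp add: avg_def t_inv_n orbit_funpow fun_eq_iff)
      then show ?thesis
        using norm_tavg_tavg[of "orbit f x" C L "t x" N, OF f_le \<open>C \<ge> 0\<close> that]
        by (simp add: avg_def)
    qed
    have avg_h: "avg (h H K) N x - avg f N x =
        ((avg (avg f H) N x - avg f N x) + (avg (avg f K) N x - avg f N x)) / 2" for x
    proof -
      have "avg (h H K) N x = (avg (avg f H) N x + avg (avg f K) N x) / 2"
        unfolding avg_def[of "h H K"] avg_def[of "avg f H"] avg_def[of "avg f K"] tavg_def h_def
        by (simp add: algebra_simps sum.distrib add_divide_distrib sum_divide_distrib)
      then show ?thesis by (simp add: field_simps)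
    qed
    have diff: "norm (avg (h H K) N x - avg f N x) \<le> C * real (H + K) / real N * 2" for x
    proof -
      let ?P = "avg (avg f H) N x - avg f N x" and ?Q = "avg (avg f K) N x - avg f N x"
      have "norm (avg (h H K) N x - avg f N x) = norm (?P + ?Q) / 2"
        by (simp only: avg_h norm_divide norm_numeral)
      moreover have "C * real (H + K) / real N * 2 = 2 * C * real H / real N + 2 * C * real K / real N"
        by (simp add: add_divide_distrib algebra_simps)
      ultimately show ?thesis
        using norm_triangle_ineq[of ?P ?Q] avg_avg[OF \<open>H > 0\<close>, of x] avg_avg[OF \<open>K > 0\<close>, of x]
          norm_ge_zero[of "?P + ?Q"] by linarith
    qed
    have avgh_le: "norm (avg (h H K) N x) \<le> C" for x
      unfolding avg_def by (intro norm_tavg_bound h_le \<open>C \<ge> 0\<close>)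
    have sq: "(norm (avg f N x))\<^sup>2 \<le> (norm (avg (h H K) N x))\<^sup>2 + 4 * C\<^sup>2 * real (H + K) / real N" for x
    proof -
      have "(norm (avg f N x))\<^sup>2 - (norm (avg (h H K) N x))\<^sup>2 =
          (norm (avg f N x) - norm (avg (h H K) N x)) * (norm (avg f N x) + norm (avg (h H K) N x))"
        by (simp add: power2_eq_square algebra_simps)
      also have "\<dots> \<le> (C * real (H + K) / real N * 2) * (C + C)"
      proof (rule mult_mono)
        show "norm (avg f N x) - norm (avg (h H K) N x) \<le> C * real (H + K) / real N * 2"
          using norm_triangle_ineq2[of "avg f N x" "avg (h H K) N x"] diff[of x]
          by (simp add: norm_minus_commute)
      qed (use avg_le[of N x] avgh_le[of x] \<open>C \<ge> 0\<close> in auto)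
      finally show ?thesis by (simp add: power2_eq_square algebra_simps)
    qed
    have "W N \<le> (\<integral>x. (norm (avg (h H K) N x))\<^sup>2 + 4 * C\<^sup>2 * real (H + K) / real N \<partial>M)"
      unfolding W_def using sq avg_le avgh_le
      by (intro integral_mono Bochner_Integration.integrable_add sq_int[of _ C]) auto
    also have "\<dots> = (\<integral>x. (norm (avg (h H K) N x))\<^sup>2 \<partial>M) + 4 * C\<^sup>2 * real (H + K) / real N"
      using avgh_le by (subst Bochner_Integration.integral_add) (auto intro!: sq_int[of _ C] simp: prob_space)
    finally show ?thesis
      using contr[of "h H K" N, OF h_meas h_le] by linarith
  qed
  define m where "m = (INF N\<in>{0<..}. W N)"
  have bdd: "bdd_below (W ` {0<..})"
    by (rule bdd_belowI[of _ 0]) (auto simp: W_def)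
  have m_le: "m \<le> W N" if "N > 0" for N
    unfolding m_def using that bdd by (intro cINF_lower) auto
  have small: "(\<lambda>N. D / real N) \<longlonglongrightarrow> 0" for D
    using tendsto_mult_right_zero[OF lim_1_over_n, of D] by simp
  have m_le_h: "m \<le> (\<integral>x. (norm (h H K x))\<^sup>2 \<partial>M)" if "H > 0" "K > 0" for H K
  proof (rule LIMSEQ_le_const)
    show "(\<lambda>N. (\<integral>x. (norm (h H K x))\<^sup>2 \<partial>M) + 4 * C\<^sup>2 * real (H + K) / real N) \<longlonglongrightarrow> (\<integral>x. (norm (h H K x))\<^sup>2 \<partial>M)"
      using tendsto_add[OF tendsto_const small] by simp
    show "\<exists>N0. \<forall>N\<ge>N0. m \<le> (\<integral>x. (norm (h H K x))\<^sup>2 \<partial>M) + 4 * C\<^sup>2 * real (H + K) / real N"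
      using m_le h_lower[OF that] by (intro exI[of _ 1]) (meson less_le_trans order_trans zero_less_one)
  qed
  have W_small: "\<forall>\<^sub>F N in sequentially. W N < m + \<delta>" if "\<delta> > 0" for \<delta>
  proof -
    have "(INF N\<in>{0<..}. W N) < m + \<delta> / 2" using that by (simp add: m_def)
    moreover have "{0::nat<..} \<noteq> {}" by blast
    ultimately obtain H where H: "H > 0" "W H < m + \<delta> / 2"
      using cINF_less_iff[OF _ bdd] by blast
    \<comment> \<open>The case \<open>K = H\<close> of \<open>h_lower\<close> compares
      \<open>W N\<close> with \<open>W H\<close>, so \<open>W\<close> is close to its infimum for
      all large \<open>N\<close>.\<close>
    have hH: "h H H = avg f H" by (simp add: h_def fun_eq_iff)
    have "\<forall>\<^sub>F N in sequentially. 4 * C\<^sup>2 * real (H + H) / real N < \<delta> / 2"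
      using order_tendstoD(2)[OF small] that by simp
    then show ?thesis
    proof eventually_elim
      case (elim N)
      then show ?case using h_lower[OF H(1) H(1), of N] H(2) by (simp add: hH W_def)
    qed
  qed
  have parallelogram: "(\<integral>x. (norm (avg f H x - avg f K x))\<^sup>2 \<partial>M) = 2 * W H + 2 * W K - 4 * (\<integral>x. (norm (h H K x))\<^sup>2 \<partial>M)"
    for H K
  proof -
    have "(norm (avg f H x - avg f K x))\<^sup>2 = 2 * (norm (avg f H x))\<^sup>2 + 2 * (norm (avg f K x))\<^sup>2 - 4 * (norm (h H K x))\<^sup>2" for x
    proof -
      have "4 * (norm (h H K x))\<^sup>2 = (norm (avg f H x + avg f K x))\<^sup>2"
        by (simp add: h_def norm_divide power_divide)
      then show ?thesis
        unfolding cmod_power2 by (simp add: power2_eq_square algebra_simps)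
    qed
    moreover have "integrable M (\<lambda>x. (norm (avg f H x))\<^sup>2)" "integrable M (\<lambda>x. (norm (avg f K x))\<^sup>2)"
      "integrable M (\<lambda>x. (norm (h H K x))\<^sup>2)"
      using avg_le h_le by (auto intro!: sq_int[of _ C])
    ultimately show ?thesis by (simp add: W_def)
  qed
  have int_avg: "integrable M (avg f N)" for N
    using avg_le by (intro integrable_bounded[of _ C]) auto
  have L1: "\<exists>N. \<forall>i\<ge>N. \<forall>j\<ge>N. (\<integral>x. norm (avg f i x - avg f j x) \<partial>M) < e" if "e > 0" for e
  proof -
    \<comment> \<open>The parallelogram law and \<open>m_le_h\<close> then leave less than
      \<open>4 * (e\<^sup>2 / 4)\<close>.\<close>
    obtain N where N: "\<And>n. n \<ge> N \<Longrightarrow> W n < m + e\<^sup>2 / 4"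
      using W_small[of "e\<^sup>2 / 4"] \<open>e > 0\<close> by (auto simp: eventually_sequentially)
    have "(\<integral>x. norm (avg f i x - avg f j x) \<partial>M) < e" if "i \<ge> max N 1" "j \<ge> max N 1" for i j
    proof -
      have sq: "integrable M (\<lambda>x. (norm (avg f i x - avg f j x))\<^sup>2)"
      proof (rule sq_int)
        show "norm (avg f i x - avg f j x) \<le> C + C" for x
          using norm_triangle_ineq4[of "avg f i x" "avg f j x"] avg_le[of i x] avg_le[of j x] by linarith
      qed simp
      have lt: "(\<integral>x. (norm (avg f i x - avg f j x))\<^sup>2 \<partial>M) < e\<^sup>2"
        using m_le_h[of i j] N[of i] N[of j] that unfolding parallelogram by auto
      have "(\<integral>x. norm (avg f i x - avg f j x) \<partial>M) \<le>
          (\<integral>x. e / 2 + (norm (avg f i x - avg f j x))\<^sup>2 / (2 * e) \<partial>M)"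
      proof (rule integral_mono)
        fix x
        \<comment> \<open>Expanding this square bounds the L1 distance by the squared L2
          distance.\<close>
        have "0 \<le> (norm (avg f i x - avg f j x) - e)\<^sup>2" by simp
        then show "norm (avg f i x - avg f j x) \<le> e / 2 + (norm (avg f i x - avg f j x))\<^sup>2 / (2 * e)"
          using \<open>e > 0\<close> by (simp add: power2_eq_square field_simps)
      qed (use int_avg sq in auto)
      also have "\<dots> = e / 2 + (\<integral>x. (norm (avg f i x - avg f j x))\<^sup>2 \<partial>M) / (2 * e)"
        using sq by (simp add: prob_space)
      also have "\<dots> < e"
        using lt \<open>e > 0\<close> by (simp add: field_simps power2_eq_square)
      finally show ?thesis .
    qed
    then show ?thesis by blast
  qed
  obtain r where r: "strict_mono r" "AE x in M. Cauchy (\<lambda>i. avg f (r i) x)"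
    using cauchy_L1_AE_cauchy_subseq[of M "avg f", OF int_avg L1] by blast
  \<comment> \<open>The convergence set is \<open>T\<close>-invariant, so the default 0 off it makes
    the functional equation for \<open>A\<close> hold at every point, not merely almost
    everywhere.\<close>
  define A where "A x = (if Cauchy (\<lambda>i. avg f (r i) x) then lim (\<lambda>i. avg f (r i) x) else 0)" for x
  have A_meas [measurable]: "A \<in> borel_measurable M"
    unfolding A_def[abs_def] by measurable
  have A_lim: "(\<lambda>i. avg f (r i) x) \<longlonglongrightarrow> A x" if "Cauchy (\<lambda>i. avg f (r i) x)" for x
    using that by (simp add: A_def Cauchy_convergent_iff convergent_LIMSEQ_iff)
  have A_le: "norm (A x) \<le> C" for x
  proof (cases "Cauchy (\<lambda>i. avg f (r i) x)")
    case True
    show ?thesis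
      by (rule Lim_norm_ubound[OF _ A_lim[OF True]]) (auto simp: avg_le)
  qed (simp add: A_def \<open>C \<ge> 0\<close>)
  have A_T: "A (T x) = A x * cis (- t x)" for x
  proof -
    \<comment> \<open>Up to a phase, one step along the orbit costs O(1 / N), so the averages at
      \<open>x\<close> and at \<open>T x\<close> converge or diverge together.\<close>
    have "(\<lambda>N. cis (t x) * avg f N (T x) - avg f N x) \<longlonglongrightarrow> 0"
    proof (rule Lim_null_comparison[OF _ small])
      show "\<forall>\<^sub>F N in sequentially. norm (cis (t x) * avg f N (T x) - avg f N x) \<le> 2 * C / real N"
        using norm_tavg_shift[of "orbit f x" C 1 "t x", OF f_le]
        by (intro always_eventually) (simp add: avg_def t_inv orbit_T del: funpow.simps)
    qed
    from LIMSEQ_subseq_LIMSEQ[OF this r(1)]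
    have null: "(\<lambda>i. cis (t x) * avg f (r i) (T x) - avg f (r i) x) \<longlonglongrightarrow> 0" by (simp add: comp_def)
    have cis_inv: "cis (- t x) * (cis (t x) * z) = z" for z
      by (simp add: mult.assoc[symmetric] cis_mult)
    show ?thesis
    proof (cases "Cauchy (\<lambda>i. avg f (r i) x)")
      case True
      have "(\<lambda>i. cis (- t x) * ((cis (t x) * avg f (r i) (T x) - avg f (r i) x) + avg f (r i) x)) \<longlonglongrightarrow> cis (- t x) * (0 + A x)"
        by (intro tendsto_intros null A_lim True)
      then have lim: "(\<lambda>i. avg f (r i) (T x)) \<longlonglongrightarrow> A x * cis (- t x)"
        by (simp add: cis_inv mult.commute)
      then have "Cauchy (\<lambda>i. avg f (r i) (T x))" by (rule LIMSEQ_imp_Cauchy)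
      from A_lim[OF this] show ?thesis using lim LIMSEQ_unique by blast
    next
      case False
      have "\<not> Cauchy (\<lambda>i. avg f (r i) (T x))"
      proof
        assume "Cauchy (\<lambda>i. avg f (r i) (T x))"
        from tendsto_diff[OF tendsto_mult[OF tendsto_const[of "cis (t x)"] A_lim[OF this]] null]
        have "(\<lambda>i. avg f (r i) x) \<longlonglongrightarrow> cis (t x) * A (T x)" by simp
        with False show False using LIMSEQ_imp_Cauchy by blast
      qed
      with False show ?thesis by (simp add: A_def)
    qed
  qed
  have A_orbit: "A ((T ^^ n) x) = A x * cis (real n * - t x)" for n x
  proof (induction n)
    case (Suc n)
    have "A ((T ^^ Suc n) x) = A ((T ^^ n) x) * cis (- t x)"
      by (simp add: A_T t_inv_n)
    also have "\<dots> = A x * (cis (real n * - t x) * cis (- t x))"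
      by (simp only: Suc mult.assoc)
    finally show ?case by (simp add: cis_mult algebra_simps)
  qed simp
  have AE_lim: "AE x in M. (\<lambda>i. avg f (r i) x) \<longlonglongrightarrow> A x"
    using r(2) by (auto elim: eventually_mono intro: A_lim)
  \<comment> \<open>The phase of \<open>A\<close> along the orbit absorbs that of the average,
    leaving translates of \<open>f x * cnj (A x)\<close>, all with the same integral.\<close>
  have inner_avg: "(\<integral>x. avg f N x * cnj (A x) \<partial>M) = (\<integral>x. f x * cnj (A x) \<partial>M)" if "N > 0" for N
  proof -
    have "avg f N x * cnj (A x) = (\<Sum>n<N. f ((T ^^ n) x) * cnj (A ((T ^^ n) x))) / of_nat N" for x
      by (simp add: avg_def tavg_def A_orbit cis_cnj sum_distrib_left sum_distrib_right mult_ac)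
    moreover have "integrable M (\<lambda>x. f ((T ^^ n) x) * cnj (A ((T ^^ n) x)))" for n
      using f_le A_le \<open>C \<ge> 0\<close> by (intro integrable_bounded[of _ "C * C"]) (auto simp: norm_mult intro!: mult_mono)
    ultimately have "(\<integral>x. avg f N x * cnj (A x) \<partial>M) =
        (\<Sum>n<N. \<integral>x. f ((T ^^ n) x) * cnj (A ((T ^^ n) x)) \<partial>M) / of_nat N"
      by simp
    also have "\<dots> = (\<integral>x. f x * cnj (A x) \<partial>M)"
      using that integral_funpow[of "\<lambda>x. f x * cnj (A x)"] by simp
    finally show ?thesis .
  qed
  have inner_lim: "(\<lambda>i. \<integral>x. avg f (r i) x * cnj (A x) \<partial>M) \<longlonglongrightarrow> (\<integral>x. A x * cnj (A x) \<partial>M)"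
  proof (rule integral_dominated_convergence[where w = "\<lambda>_. C * C"])
    show "AE x in M. (\<lambda>i. avg f (r i) x * cnj (A x)) \<longlonglongrightarrow> A x * cnj (A x)"
      using AE_lim by eventually_elim (intro tendsto_intros)
    show "AE x in M. norm (avg f (r i) x * cnj (A x)) \<le> C * C" for i
      using avg_le A_le \<open>C \<ge> 0\<close> by (auto simp: norm_mult intro!: mult_mono)
  qed auto
  have inner_ev: "\<forall>\<^sub>F i in sequentially. (\<integral>x. avg f (r i) x * cnj (A x) \<partial>M) = (\<integral>x. f x * cnj (A x) \<partial>M)"
    using eventually_gt_at_top[of 0]
  proof eventually_elim
    case (elim i)
    then show ?case using seq_suble[OF r(1), of i] by (intro inner_avg) simp
  qed
  have inner: "(\<integral>x. A x * cnj (A x) \<partial>M) = (\<integral>x. f x * cnj (A x) \<partial>M)"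
    by (rule LIMSEQ_unique[OF inner_lim tendsto_eventually[OF inner_ev]])
  have int_fA: "integrable M (\<lambda>x. f x * cnj (A x))" and int_AA: "integrable M (\<lambda>x. A x * cnj (A x))"
    using f_le A_le \<open>C \<ge> 0\<close>
    by (auto intro!: integrable_bounded[of _ "C * C"] mult_mono simp: norm_mult)
  \<comment> \<open>By \<open>inner\<close>, \<open>f - A\<close> is orthogonal to \<open>A\<close>;
    this is Pythagoras.\<close>
  have energy: "(\<integral>x. (norm (f x - A x))\<^sup>2 \<partial>M) = (\<integral>x. (norm (f x))\<^sup>2 \<partial>M) - (\<integral>x. (norm (A x))\<^sup>2 \<partial>M)"
  proof -
    define g where "g x = f x * cnj (A x)" for x
    have "(norm (f x - A x))\<^sup>2 = (norm (f x))\<^sup>2 - 2 * Re (f x * cnj (A x)) + (norm (A x))\<^sup>2" for x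
      unfolding cmod_power2 by (simp add: power2_eq_square algebra_simps)
    then have expand: "(norm (f x - A x))\<^sup>2 = (norm (f x))\<^sup>2 - 2 * Re (g x) + (norm (A x))\<^sup>2" for x
      by (simp only: g_def)
    have "integrable M g" using int_fA by (simp add: g_def[abs_def])
    then have "(\<integral>x. (norm (f x - A x))\<^sup>2 \<partial>M) =
        (\<integral>x. (norm (f x))\<^sup>2 \<partial>M) - 2 * Re (\<integral>x. g x \<partial>M) + (\<integral>x. (norm (A x))\<^sup>2 \<partial>M)"
      using sq_int[OF f f_le] sq_int[OF A_meas A_le] by (simp add: expand)
    also have "Re (\<integral>x. g x \<partial>M) = (\<integral>x. (norm (A x))\<^sup>2 \<partial>M)"
    proof -
      have "Re (A x * cnj (A x)) = (norm (A x))\<^sup>2" for x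
        unfolding cmod_power2 by (simp add: power2_eq_square)
      then show ?thesis using integral_Re[OF int_AA] by (simp only: g_def inner[symmetric])
    qed
    finally show ?thesis by simp
  qed
  show thesis
  proof (rule that[OF A_meas A_le A_orbit energy])
    fix B :: "'a set" and e :: real
    assume B [measurable]: "B \<in> sets M"
      and e: "\<And>H. H > 0 \<Longrightarrow> e \<le> (\<integral>x. indicator B x * norm (tavg (t x) (orbit f x) H) \<partial>M)"
    have "(\<lambda>i. \<integral>x. indicator B x * norm (avg f (r i) x) \<partial>M) \<longlonglongrightarrow> (\<integral>x. indicator B x * norm (A x) \<partial>M)"
    proof (rule integral_dominated_convergence[where w = "\<lambda>_. C"])
      show "AE x in M. (\<lambda>i. indicator B x * norm (avg f (r i) x)) \<longlonglongrightarrow> indicator B x * norm (A x)"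
        using AE_lim by eventually_elim (intro tendsto_intros)
      show "AE x in M. norm (indicator B x * norm (avg f (r i) x)) \<le> C" for i
        using avg_le \<open>C \<ge> 0\<close> by (auto simp: indicator_def)
    qed auto
    then show "e \<le> (\<integral>x. indicator B x * norm (A x) \<partial>M)"
    proof (rule LIMSEQ_le_const)
      show "\<exists>N. \<forall>i\<ge>N. e \<le> (\<integral>x. indicator B x * norm (avg f (r i) x) \<partial>M)"
      proof (intro exI[of _ 1] allI impI)
        fix i :: nat assume "i \<ge> 1"
        then have "r i > 0" using seq_suble[OF r(1), of i] by simp
        then show "e \<le> (\<integral>x. indicator B x * norm (avg f (r i) x) \<partial>M)"
          using e by (simp add: avg_def)
      qed
    qed
  qed
qed

subsection \<open>Approximation along orbits\<close>

lemma large_freq_below_T: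
  assumes "\<And>x. norm (f x) \<le> C"
  shows "large_freq_below \<epsilon> r (orbit f (T x)) \<longleftrightarrow> large_freq_below \<epsilon> r (orbit f x)"
  unfolding orbit_T by (rule large_freq_below_Suc) (rule assms)

lemma measurable_large_freq_below [measurable]:
  assumes [measurable]: "f \<in> borel_measurable M"
  shows "{x \<in> space M. large_freq_below \<epsilon> r (orbit f x)} \<in> sets M"
  unfolding large_freq_below_def tavg_def by measurable

lemma measurable_first_large_freq:
  assumes [measurable]: "f \<in> borel_measurable M"
  shows "(\<lambda>x. first_large_freq \<epsilon> (orbit f x)) \<in> borel_measurable M"
  unfolding borel_measurable_iff_less first_large_freq_less_iff by measurable

text \<open>Every orbit must give a trigonometric polynomial, with no exceptional set; boundedness
  keeps \<open>f - p\<close> within reach of the energy decrement.\<close>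

definition structured :: "('a \<Rightarrow> complex) \<Rightarrow> bool"
  where "structured p \<longleftrightarrow> p \<in> borel_measurable M \<and> (\<exists>K. \<forall>x. norm (p x) \<le> K) \<and> (\<forall>x. trig_poly (orbit p x))"

text \<open>The maximal ergodic theorem bounds the integral over \<open>B\<close> of the block
  averages at frequency \<open>t x\<close> from below, for every block length \<open>H\<close>. The
  limit \<open>A\<close> inherits the bound, and Pythagoras turns it into an energy drop.\<close>

lemma energy_decrement:
  assumes f [measurable]: "f \<in> borel_measurable M" and f_le: "\<And>x. norm (f x) \<le> C" and "\<epsilon> > 0"
  obtains A t where "A \<in> borel_measurable M" and "\<And>x. norm (A x) \<le> C"
    and "\<And>x n. A ((T ^^ n) x) = A x * cis (real n * t x)"
    and "(\<integral>x. (norm (f x - A x))\<^sup>2 \<partial>M) \<le> (\<integral>x. (norm (f x))\<^sup>2 \<partial>M) -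
      \<epsilon>\<^sup>2 * measure M {x \<in> space M. large_freq_below \<epsilon> 8 (orbit f x)}"
proof -
  have "C \<ge> 0" using f_le[of undefined] norm_ge_zero order_trans by blast
  define t where "t x = first_large_freq \<epsilon> (orbit f x)" for x
  define B where "B = {x \<in> space M. large_freq_below \<epsilon> 8 (orbit f x)}"
  have t [measurable]: "t \<in> borel_measurable M"
    unfolding t_def[abs_def] by (rule measurable_first_large_freq) fact
  have B [measurable]: "B \<in> sets M" unfolding B_def by measurable
  have t_inv: "t (T x) = t x" for x
    unfolding t_def first_large_freq_def by (simp only: large_freq_below_T[of f C, OF f_le])
  have t_inv_n: "t ((T ^^ n) x) = t x" for n x
    by (induction n) (simp_all add: t_inv)
  have large: "\<epsilon> * measure M B \<le> (\<integral>x. indicator B x * norm (tavg (t x) (orbit f x) H) \<partial>M)" if "H > 0" for H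
  proof (rule ccontr)
    define G where "G x = norm (tavg (t x) (orbit f x) H)" for x
    define I where "I = (\<integral>x. indicator B x * G x \<partial>M)"
    have [measurable]: "G \<in> borel_measurable M"
      unfolding G_def[abs_def] tavg_def cis_conv_exp by measurable
    have G_le: "\<bar>G x\<bar> \<le> C" for x
      unfolding G_def using norm_tavg_bound[of "orbit f x" C "t x" H] f_le \<open>C \<ge> 0\<close> by simp
    assume "\<not> \<epsilon> * measure M B \<le> (\<integral>x. indicator B x * norm (tavg (t x) (orbit f x) H) \<partial>M)"
    then have less: "I < \<epsilon> * measure M B" by (simp add: I_def G_def)
    have "I \<ge> 0" unfolding I_def G_def by (intro integral_nonneg_AE) auto
    then have pos: "measure M B > 0"
      using less by (auto simp: zero_less_measure_iff)
    have "I / measure M B < \<epsilon>" using less pos by (simp add: divide_less_eq)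
    \<comment> \<open>\<open>block_averages_large\<close> asks for \<open>e\<close> strictly below
      \<open>\<epsilon>\<close>; the negated inequality leaves room for one.\<close>
    then obtain e where e: "I / measure M B < e" and "e < \<epsilon>" using dense by blast
    have "e * measure M B \<le> (\<integral>x. indicator B x * G x \<partial>M)"
    proof (rule maximal_ergodic[of G C])
      show "T x \<in> B \<longleftrightarrow> x \<in> B" if "x \<in> space M" for x
        using that measurable_space[OF measurable_T that] by (simp add: B_def large_freq_below_T[of f C, OF f_le])
      show "\<exists>N>0. e * real N < (\<Sum>n<N. G ((T ^^ n) x))" if "x \<in> B" for x
        using block_averages_large[of "orbit f x" C \<epsilon> H e] that f_le \<open>H > 0\<close> \<open>e < \<epsilon>\<close>
        by (simp add: B_def G_def t_inv_n orbit_funpow t_def[symmetric])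
    qed (use G_le in auto)
    then have "e * measure M B \<le> I" by (simp only: I_def)
    moreover have "I < e * measure M B" using e pos by (simp add: divide_less_eq)
    ultimately show False by simp
  qed
  obtain A where A [measurable]: "A \<in> borel_measurable M" and A_le: "\<And>x. norm (A x) \<le> C"
    and A_orbit: "\<And>x n. A ((T ^^ n) x) = A x * cis (real n * - t x)"
    and energy: "(\<integral>x. (norm (f x - A x))\<^sup>2 \<partial>M) = (\<integral>x. (norm (f x))\<^sup>2 \<partial>M) - (\<integral>x. (norm (A x))\<^sup>2 \<partial>M)"
    and A_large: "\<And>B e. B \<in> sets M \<Longrightarrow>
      (\<And>H. H > 0 \<Longrightarrow> e \<le> (\<integral>x. indicator B x * norm (tavg (t x) (orbit f x) H) \<partial>M)) \<Longrightarrow>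
      e \<le> (\<integral>x. indicator B x * norm (A x) \<partial>M)"
    using mean_ergodic[OF f f_le t t_inv] by blast
  have int1: "integrable M (\<lambda>x. indicator B x * norm (A x))"
    using A_le \<open>C \<ge> 0\<close> by (intro integrable_bounded[of _ C]) (auto simp: indicator_def)
  have int2: "integrable M (\<lambda>x. indicator B x :: real)"
    by (intro integrable_bounded[of _ 1]) (auto simp: indicator_def)
  \<comment> \<open>The pointwise bound
    \<open>2 * \<epsilon> * a - \<epsilon>\<^sup>2 \<le> a\<^sup>2\<close>, integrated over
    \<open>B\<close>, takes the place of Cauchy-Schwarz.\<close>
  have "\<epsilon>\<^sup>2 * measure M B \<le> 2 * \<epsilon> * (\<integral>x. indicator B x * norm (A x) \<partial>M) - \<epsilon>\<^sup>2 * measure M B"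
    using mult_left_mono[OF A_large[OF B large], of "2 * \<epsilon>"] \<open>\<epsilon> > 0\<close>
    by (simp add: power2_eq_square algebra_simps)
  also have "\<dots> = (\<integral>x. 2 * \<epsilon> * (indicator B x * norm (A x)) - \<epsilon>\<^sup>2 * indicator B x \<partial>M)"
    using int1 int2 by simp
  also have "\<dots> \<le> (\<integral>x. (norm (A x))\<^sup>2 \<partial>M)"
  proof (rule integral_mono)
    show "integrable M (\<lambda>x. (norm (A x))\<^sup>2)"
      using A_le by (intro integrable_bounded[of _ "C\<^sup>2"]) (auto intro: power_mono)
    show "2 * \<epsilon> * (indicator B x * norm (A x)) - \<epsilon>\<^sup>2 * indicator B x \<le> (norm (A x))\<^sup>2" for x
      using sum_squares_bound[of \<epsilon> "norm (A x)"] by (auto simp: indicator_def)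
  qed (use int1 int2 in simp)
  finally have "(\<integral>x. (norm (f x - A x))\<^sup>2 \<partial>M) \<le> (\<integral>x. (norm (f x))\<^sup>2 \<partial>M) - \<epsilon>\<^sup>2 * measure M B"
    using energy by linarith
  then show thesis
    using that[of A "\<lambda>x. - t x"] A A_le A_orbit by (simp add: B_def)
qed

text \<open>The infimum of the energy need not be attained: for \<open>p\<close> within
  \<open>\<epsilon>\<^sup>2 * \<delta>\<close> of it, a bad set of measure at least
  \<open>\<delta>\<close> would let \<open>p + A\<close> fall below the infimum.\<close>

lemma structured_approx:
  assumes f [measurable]: "f \<in> borel_measurable M" and f_le: "\<And>x. norm (f x) \<le> C"
    and "\<epsilon> > 0" "\<delta> > 0"
  obtains p where "structured p"
    and "measure M {x \<in> space M. large_freq_below \<epsilon> 8 (orbit (\<lambda>y. f y - p y) x)} < \<delta>"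
proof -
  define E where "E p = (\<integral>x. (norm (f x - p x))\<^sup>2 \<partial>M)" for p
  have "structured (\<lambda>x. 0)" by (auto simp: structured_def trig_poly.zero)
  then have ne: "Collect structured \<noteq> {}" by blast
  have bdd: "bdd_below (E ` Collect structured)"
    by (rule bdd_belowI[of _ 0]) (auto simp: E_def)
  have "(INF p\<in>Collect structured. E p) < (INF p\<in>Collect structured. E p) + \<epsilon>\<^sup>2 * \<delta>"
    using assms by simp
  then obtain p where p: "structured p" "E p < (INF p\<in>Collect structured. E p) + \<epsilon>\<^sup>2 * \<delta>"
    using cINF_less_iff[OF ne bdd] by blast
  then obtain K where p_meas [measurable]: "p \<in> borel_measurable M" and K: "\<And>x. norm (p x) \<le> K"
    and p_orbit: "\<And>x. trig_poly (orbit p x)"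
    by (auto simp: structured_def)
  have diff_le: "norm (f x - p x) \<le> C + K" for x
    using norm_triangle_ineq4[of "f x" "p x"] f_le[of x] K[of x] by linarith
  obtain A t where A [measurable]: "A \<in> borel_measurable M" and A_le: "\<And>x. norm (A x) \<le> C + K"
    and A_orbit: "\<And>x n. A ((T ^^ n) x) = A x * cis (real n * t x)"
    and decr: "(\<integral>x. (norm (f x - p x - A x))\<^sup>2 \<partial>M) \<le> (\<integral>x. (norm (f x - p x))\<^sup>2 \<partial>M) -
      \<epsilon>\<^sup>2 * measure M {x \<in> space M. large_freq_below \<epsilon> 8 (orbit (\<lambda>y. f y - p y) x)}"
    using energy_decrement[of "\<lambda>y. f y - p y" "C + K" \<epsilon>] diff_le \<open>\<epsilon> > 0\<close> by auto
  have "structured (\<lambda>x. p x + A x)"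
  proof -
    have "norm (p x + A x) \<le> K + (C + K)" for x
      using norm_triangle_ineq[of "p x" "A x"] K[of x] A_le[of x] by linarith
    moreover have "trig_poly (orbit (\<lambda>x. p x + A x) x)" for x
      using trig_poly.add[OF p_orbit[of x], of "A x" "t x"] by (simp add: A_orbit)
    ultimately show ?thesis by (auto simp: structured_def)
  qed
  then have "(INF p\<in>Collect structured. E p) \<le> E (\<lambda>x. p x + A x)"
    by (intro cINF_lower bdd) simp
  also have "\<dots> \<le> E p - \<epsilon>\<^sup>2 * measure M {x \<in> space M. large_freq_below \<epsilon> 8 (orbit (\<lambda>y. f y - p y) x)}"
    using decr by (simp add: E_def diff_diff_eq)
  finally have "\<epsilon>\<^sup>2 * measure M {x \<in> space M. large_freq_below \<epsilon> 8 (orbit (\<lambda>y. f y - p y) x)} < \<epsilon>\<^sup>2 * \<delta>"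
    using p(2) by linarith
  then show thesis
    using that[OF p(1)] \<open>\<epsilon> > 0\<close> by simp
qed

text \<open>For fixed \<open>\<epsilon>\<close>, the bad sets of a sequence of approximants have
  null intersection, so almost every point escapes one of them; which one may depend on the
  point.\<close>

lemma AE_uniformly_trig_approx:
  assumes f [measurable]: "f \<in> borel_measurable M" and f_le: "\<And>x. norm (f x) \<le> C"
  shows "AE x in M. uniformly_trig_approx (orbit f x)"
proof -
  have *: "AE x in M. \<exists>q. trig_poly q \<and> (\<forall>\<^sub>F N in sequentially. \<forall>s. norm (tavg s (\<lambda>n. orbit f x n - q n) N) \<le> \<epsilon>)"
    if "\<epsilon> > 0" for \<epsilon>
  proof -
    have "\<exists>p. structured p \<and> measure M {x \<in> space M. large_freq_below \<epsilon> 8 (orbit (\<lambda>y. f y - p y) x)} < 1 / real (Suc j)" for j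
      using structured_approx[OF f f_le that, of "1 / real (Suc j)"] by auto
    then have "\<exists>p. \<forall>j. structured (p j) \<and>
        measure M {x \<in> space M. large_freq_below \<epsilon> 8 (orbit (\<lambda>y. f y - p j y) x)} < 1 / real (Suc j)"
      by (intro choice allI)
    then obtain p where p: "\<And>j. structured (p j)"
      and small: "\<And>j. measure M {x \<in> space M. large_freq_below \<epsilon> 8 (orbit (\<lambda>y. f y - p j y) x)} < 1 / real (Suc j)"
      by blast
    have [measurable]: "p j \<in> borel_measurable M" for j using p by (simp add: structured_def)
    define B where "B j = {x \<in> space M. large_freq_below \<epsilon> 8 (orbit (\<lambda>y. f y - p j y) x)}" for j
    have B [measurable]: "B j \<in> sets M" for j unfolding B_def by measurable
    have "measure M (\<Inter>j. B j) \<le> 0"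
    proof (rule LIMSEQ_le_const[OF LIMSEQ_inverse_real_of_nat], intro exI allI impI)
      fix j
      have "measure M (\<Inter>j. B j) \<le> measure M (B j)"
        by (intro finite_measure_mono) auto
      also have "\<dots> \<le> inverse (real (Suc j))"
        using small[of j] by (simp add: B_def inverse_eq_divide)
      finally show "measure M (\<Inter>j. B j) \<le> inverse (real (Suc j))" .
    qed
    then have "measure M (\<Inter>j. B j) = 0"
      by (rule antisym[OF _ measure_nonneg])
    then have "(\<Inter>j. B j) \<in> null_sets M"
      by (intro null_setsI) (auto simp: emeasure_eq_measure)
    then have "AE x in M. x \<notin> (\<Inter>j. B j)" by (rule AE_not_in)
    then show ?thesis
    proof (rule AE_mp, intro AE_I2 impI)
      fix x assume "x \<in> space M" "x \<notin> (\<Inter>j. B j)"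
      then obtain j where "\<not> large_freq_below \<epsilon> 8 (\<lambda>n. orbit f x n - orbit (p j) x n)"
        by (auto simp: B_def)
      from not_large_freq_below[OF this]
      show "\<exists>q. trig_poly q \<and> (\<forall>\<^sub>F N in sequentially. \<forall>s. norm (tavg s (\<lambda>n. orbit f x n - q n) N) \<le> \<epsilon>)"
        using p by (intro exI[of _ "orbit (p j) x"]) (auto simp: structured_def)
    qed
  qed
  \<comment> \<open>Countably many tolerances suffice, so the exceptional sets combine into one null
    set.\<close>
  have "AE x in M. \<forall>i. \<exists>q. trig_poly q \<and>
      (\<forall>\<^sub>F N in sequentially. \<forall>s. norm (tavg s (\<lambda>n. orbit f x n - q n) N) \<le> inverse (real (Suc i)))"
    unfolding AE_all_countable using * by simp
  then show ?thesis
  proof eventually_elim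
    case (elim x)
    show ?case
      unfolding uniformly_trig_approx_def
    proof (intro allI impI)
      fix \<epsilon> :: real assume "\<epsilon> > 0"
      then obtain i where i: "inverse (real (Suc i)) < \<epsilon>" using reals_Archimedean by blast
      obtain q where "trig_poly q"
        and q: "\<forall>\<^sub>F N in sequentially. \<forall>s. norm (tavg s (\<lambda>n. orbit f x n - q n) N) \<le> inverse (real (Suc i))"
        using elim by blast
      have "\<forall>\<^sub>F N in sequentially. \<forall>s. norm (tavg s (\<lambda>n. orbit f x n - q n) N) \<le> \<epsilon>"
        using q by (rule eventually_mono) (use i in \<open>meson less_imp_le order_trans\<close>)
      with \<open>trig_poly q\<close> show "\<exists>q. trig_poly q \<and>
          (\<forall>\<^sub>F N in sequentially. \<forall>s. norm (tavg s (\<lambda>n. orbit f x n - q n) N) \<le> \<epsilon>)" by blast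
    qed
  qed
qed

end

section \<open>Almost everywhere convergence of the cubic averages\<close>

theorem theorem4:
  fixes M :: "'a measure" and T :: "'a \<Rightarrow> 'a"
    and f1 f2 f3 :: "'a \<Rightarrow> complex"
  assumes "measure_preserving_system M T"
    and "f1 \<in> borel_measurable M" and "bounded (f1 ` space M)"
    and "f2 \<in> borel_measurable M" and "bounded (f2 ` space M)"
    and "f3 \<in> borel_measurable M" and "bounded (f3 ` space M)"
  shows "AE x in M. convergent (\<lambda>N. cubic_average T f1 f2 f3 N x)"
proof -
  interpret measure_preserving_system M T by fact
  \<comment> \<open>The given bounds hold on \<open>space M\<close> only. Cutting off makes them
    global and changes no orbit that starts in \<open>space M\<close>.\<close>
  define cut where "cut f x = (if x \<in> space M then f x else 0)" for f :: "'a \<Rightarrow> complex" and x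
  have cut_orbit: "orbit (cut f) x = orbit f x" if "x \<in> space M" for f x
    using that by (simp add: cut_def funpow_in_space)
  obtain C1 where C1: "\<And>x. x \<in> space M \<Longrightarrow> norm (f1 x) \<le> C1"
    using assms(3) by (auto simp: bounded_iff)
  obtain C2 where C2: "\<And>x. x \<in> space M \<Longrightarrow> norm (f2 x) \<le> C2"
    using assms(5) by (auto simp: bounded_iff)
  obtain C3 where C3: "\<And>x. x \<in> space M \<Longrightarrow> norm (f3 x) \<le> C3"
    using assms(7) by (auto simp: bounded_iff)
  \<comment> \<open>The 0 covers points outside \<open>space M\<close>, where the cut functions
    vanish.\<close>
  define C where "C = max 0 (max C1 (max C2 C3))"
  have cut_le: "norm (cut f1 x) \<le> C" "norm (cut f2 x) \<le> C" "norm (cut f3 x) \<le> C" for x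
    using C1[of x] C2[of x] C3[of x] by (auto simp: cut_def C_def)
  have cut_meas: "cut f \<in> borel_measurable M" if "f \<in> borel_measurable M" for f
    using that by (subst measurable_cong[of M "cut f" f]) (simp_all add: cut_def)
  have "AE x in M. uniformly_trig_approx (orbit (cut f1) x)"
    "AE x in M. uniformly_trig_approx (orbit (cut f2) x)"
    "AE x in M. uniformly_trig_approx (orbit (cut f3) x)"
    using cut_le assms(2,4,6) by (auto intro!: AE_uniformly_trig_approx[where C = C] cut_meas)
  then show ?thesis
    using AE_space
  proof eventually_elim
    case (elim x)
    have "convergent (\<lambda>N. cubic_sum (orbit (cut f1) x) (orbit (cut f2) x) (orbit (cut f3) x) N / (of_nat N)\<^sup>2)"
      by (rule convergent_cubic_of_approx[OF elim(1-3) cut_le(1,2)])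
    then show ?case
      unfolding cut_orbit[OF elim(4)] by (simp add: cubic_average_def cubic_sum_def)
  qed
qed

end
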